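(* There exists a strong (Medvedev) degree $\mathbf r\in\mathbb D_{\mathsf s}$ such that the initial segment $\mathbb D_{\mathsf s}[\mathbf 0,\mathbf r]=\{\mathbf a\in\mathbb D_{\mathsf s}:\mathbf 0\le \mathbf a\le\mathbf r\}$ of the lattice of strong degrees has dual theory exactly intuitionistic propositional logic: $\mathsf{Th}^\circ\bigl(\mathbb D_{\mathsf s}[\mathbf 0,\mathbf r]\bigr)=\mathsf{IPC}$.
   Context: Strong degrees. For $P,Q\subseteq{}^\omega\omega$ write $P\le_{\mathsf s}Q$ iff there is a partial recursive functional $\Phi$ such that for every $g\in Q$, $\Phi(g)$ is total and belongs to $P$. $\equiv_{\mathsf s}$ is the induced equivalence relation and $\mathbb D_{\mathsf s}$ is the set of $\equiv_{\mathsf s}$-classes of all subsets of ${}^\omega\omega$ (including $\emptyset$), ordered by $\le_{\mathsf s}$. It is a bounded distributive lattice with least element $\mathbf 0$ the degree of ${}^\omega\omega$, greatest element the degree of $\emptyset$, join induced by $\{f\oplus g: f\in P,\ g\in Q\}$ and meet induced by $\{(0)^\frown f:f\in P\}\cup\{(1)^\frown g:g\in Q\}$. Dual-implicative lattices. A bounded lattice $L$ is implicative if for all $a,b\in L$ there is a greatest $c$, denoted $a\rightarrow b$, with $a\wedge c\le b$. $L$ is dual-implicative if its order dual $L^\circ$ is implicative, i.e. for all $a,b\in L$ there is a least $c$ with $b\le a\vee c$. $\mathbb D_{\mathsf s}$ is dual-implicative, and so is each of its closed intervals (with the induced order). Theories. Propositional sentences are built from atomic sentences $p_0,p_1,\dots$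 with $\land,\lor,\rightarrow,\neg$. For an implicative lattice $L$ with least element $0$ and greatest element $1$, an $L$-valuation is a map $v$ from propositional sentences to $L$ with $v(\phi\land\psi)=v(\phi)\wedge v(\psi)$, $v(\phi\lor\psi)=v(\phi)\vee v(\psi)$, $v(\phi\rightarrow\psi)=v(\phi)\rightarrow v(\psi)$, $v(\neg\phi)=v(\phi)\rightarrow 0$. $\mathsf{Th}(L)$ is the set of sentences $\phi$ with $v(\phi)=1$ for every $L$-valuation $v$. For dual-implicative $L$, $\mathsf{Th}^\circ(L):=\mathsf{Th}(L^\circ)$. $\mathsf{IPC}$ is the set of propositional sentences provable in the intuitionistic propositional calculus. *)

theory Defs
  imports "HOL-Algebra.Lattice" "HOL-Library.Nat_Bijection"
begin

definition minimize :: "(nat \<rightharpoonup> nat) \<Rightarrow> nat option" where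
  "minimize f =
    (if \<exists>m. f m = Some 0 \<and> (\<forall>k<m. f k \<noteq> None)
     then Some (LEAST m. f m = Some 0) else None)"

text \<open>
  Kleene's schemata of partial recursion relative to a function \<open>g\<close>, with one program
  computing uniformly in \<open>g\<close>. Functions of several arguments are coded as unary ones through the
  Cantor pairing function, so the usual projections and tuplings become the schemata \<open>left\<close>,
  \<open>right\<close> and \<open>pair\<close>. A value \<open>None\<close> means divergence, and divergence of a
  subcomputation propagates.
\<close>

inductive partial_recursive_functional :: "((nat \<Rightarrow> nat) \<Rightarrow> nat \<rightharpoonup> nat) \<Rightarrow> bool" where
  query: "partial_recursive_functional (\<lambda>g n. Some (g n))"
| zero: "partial_recursive_functional (\<lambda>g n. Some 0)"
| succ: "partial_recursive_functional (\<lambda>g n. Some (Suc n))"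
| left: "partial_recursive_functional (\<lambda>g n. Some (fst (prod_decode n)))"
| right: "partial_recursive_functional (\<lambda>g n. Some (snd (prod_decode n)))"
| pair: "partial_recursive_functional \<Phi> \<Longrightarrow> partial_recursive_functional \<Psi> \<Longrightarrow>
    partial_recursive_functional
      (\<lambda>g n. Option.bind (\<Phi> g n) (\<lambda>a. Option.bind (\<Psi> g n) (\<lambda>b. Some (prod_encode (a, b)))))"
| comp: "partial_recursive_functional \<Phi> \<Longrightarrow> partial_recursive_functional \<Psi> \<Longrightarrow>
    partial_recursive_functional (\<lambda>g n. Option.bind (\<Phi> g n) (\<Psi> g))"
| prec: "partial_recursive_functional \<Phi> \<Longrightarrow> partial_recursive_functional \<Psi> \<Longrightarrow>
    partial_recursive_functional
      (\<lambda>g n. rec_nat (\<Phi> g (fst (prod_decode n)))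
        (\<lambda>y r. Option.bind r
           (\<lambda>v. \<Psi> g (prod_encode (fst (prod_decode n), prod_encode (y, v)))))
        (snd (prod_decode n)))"
| mu: "partial_recursive_functional \<Phi> \<Longrightarrow>
    partial_recursive_functional (\<lambda>g n. minimize (\<lambda>m. \<Phi> g (prod_encode (n, m))))"

lemma partial_recursive_functional_subst:
  assumes "partial_recursive_functional \<Psi>" and \<Phi>: "partial_recursive_functional \<Phi>"
  shows "\<exists>\<Theta>. partial_recursive_functional \<Theta> \<and>
    (\<forall>g f. (\<forall>n. \<Phi> g n = Some (f n)) \<longrightarrow> \<Theta> g = \<Psi> f)"
  using assms(1)
proof induction
  case query
  show ?case by (rule exI[of _ \<Phi>]) (auto simp: \<Phi>)
next
  case zero
  show ?case by (rule exI, rule conjI, rule partial_recursive_functional.zero) auto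
next
  case succ
  show ?case by (rule exI, rule conjI, rule partial_recursive_functional.succ) auto
next
  case left
  show ?case by (rule exI, rule conjI, rule partial_recursive_functional.left) auto
next
  case right
  show ?case by (rule exI, rule conjI, rule partial_recursive_functional.right) auto
next
  case (pair A B)
  then obtain A' B' where AB: "partial_recursive_functional A'" "partial_recursive_functional B'"
    and eq: "\<And>g f. \<forall>n. \<Phi> g n = Some (f n) \<Longrightarrow> A' g = A f"
      "\<And>g f. \<forall>n. \<Phi> g n = Some (f n) \<Longrightarrow> B' g = B f"
    by metis
  show ?case
    by (rule exI, rule conjI, rule partial_recursive_functional.pair[OF AB])
      (intro allI impI, frule eq(1), drule eq(2), simp)
next
  case (comp A B)
  then obtain A' B' where AB: "partial_recursive_functional A'" "partial_recursive_functional B'"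
    and eq: "\<And>g f. \<forall>n. \<Phi> g n = Some (f n) \<Longrightarrow> A' g = A f"
      "\<And>g f. \<forall>n. \<Phi> g n = Some (f n) \<Longrightarrow> B' g = B f"
    by metis
  show ?case
    by (rule exI, rule conjI, rule partial_recursive_functional.comp[OF AB])
      (intro allI impI, frule eq(1), drule eq(2), simp)
next
  case (prec A B)
  then obtain A' B' where AB: "partial_recursive_functional A'" "partial_recursive_functional B'"
    and eq: "\<And>g f. \<forall>n. \<Phi> g n = Some (f n) \<Longrightarrow> A' g = A f"
      "\<And>g f. \<forall>n. \<Phi> g n = Some (f n) \<Longrightarrow> B' g = B f"
    by metis
  show ?case
    by (rule exI, rule conjI, rule partial_recursive_functional.prec[OF AB])
      (intro allI impI, frule eq(1), drule eq(2), simp)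
next
  case (mu A)
  then obtain A' where A': "partial_recursive_functional A'"
    and eq: "\<And>g f. \<forall>n. \<Phi> g n = Some (f n) \<Longrightarrow> A' g = A f"
    by metis
  show ?case
    by (rule exI, rule conjI, rule partial_recursive_functional.mu[OF A'])
      (intro allI impI, drule eq, simp)
qed

definition strong_le :: "(nat \<Rightarrow> nat) set \<Rightarrow> (nat \<Rightarrow> nat) set \<Rightarrow> bool" where
  "strong_le P Q \<longleftrightarrow> (\<exists>\<Phi>. partial_recursive_functional \<Phi> \<and>
     (\<forall>g\<in>Q. \<exists>f\<in>P. \<forall>n. \<Phi> g n = Some (f n)))"

lemma strong_le_superset: "Q \<subseteq> P \<Longrightarrow> strong_le P Q"
  unfolding strong_le_def using partial_recursive_functional.query by blast

lemma strong_le_trans: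
  assumes "strong_le P Q" "strong_le Q R"
  shows "strong_le P R"
proof -
  obtain \<Psi> where \<Psi>: "partial_recursive_functional \<Psi>"
    "\<And>g. g \<in> Q \<Longrightarrow> \<exists>f\<in>P. \<forall>n. \<Psi> g n = Some (f n)"
    using assms(1) unfolding strong_le_def by blast
  obtain \<Phi> where \<Phi>: "partial_recursive_functional \<Phi>"
    "\<And>g. g \<in> R \<Longrightarrow> \<exists>f\<in>Q. \<forall>n. \<Phi> g n = Some (f n)"
    using assms(2) unfolding strong_le_def by blast
  obtain \<Theta> where "partial_recursive_functional \<Theta>"
    "\<And>g f. \<forall>n. \<Phi> g n = Some (f n) \<Longrightarrow> \<Theta> g = \<Psi> f"
    using partial_recursive_functional_subst[OF \<Psi>(1) \<Phi>(1)] by blast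
  then show ?thesis
    unfolding strong_le_def using \<Psi>(2) \<Phi>(2) by metis
qed

definition strong_equiv :: "(nat \<Rightarrow> nat) set \<Rightarrow> (nat \<Rightarrow> nat) set \<Rightarrow> bool" where
  "strong_equiv P Q \<longleftrightarrow> strong_le P Q \<and> strong_le Q P"

quotient_type strong_degree = "(nat \<Rightarrow> nat) set" / strong_equiv
  by (rule equivpI)
    (auto simp: reflp_def symp_def transp_def strong_equiv_def
      intro: strong_le_superset strong_le_trans)

instantiation strong_degree :: "{order_bot, order_top}"
begin

lift_definition less_eq_strong_degree :: "strong_degree \<Rightarrow> strong_degree \<Rightarrow> bool" is strong_le
  by (auto simp: strong_equiv_def intro: strong_le_trans)

definition less_strong_degree :: "strong_degree \<Rightarrow> strong_degree \<Rightarrow> bool" where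
  "less_strong_degree a b \<longleftrightarrow> a \<le> b \<and> \<not> b \<le> a"

lift_definition bot_strong_degree :: strong_degree is UNIV .

lift_definition top_strong_degree :: strong_degree is "{}" .

instance
proof
  fix a b c :: strong_degree
  show "a < b \<longleftrightarrow> a \<le> b \<and> \<not> b \<le> a"
    by (rule less_strong_degree_def)
  show "a \<le> a"
    by transfer (simp add: strong_le_superset)
  show "a \<le> b \<Longrightarrow> b \<le> c \<Longrightarrow> a \<le> c"
    by transfer (rule strong_le_trans)
  show "a \<le> b \<Longrightarrow> b \<le> a \<Longrightarrow> a = b"
    by transfer (simp add: strong_equiv_def)
  show "bot \<le> a"
    by transfer (simp add: strong_le_superset)
  show "a \<le> Orderings.top"
    by transfer (simp add: strong_le_superset)
qed

end

definition interval_order :: "'a::order \<Rightarrow> 'a \<Rightarrow> 'a gorder" where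
  "interval_order a b = \<lparr>carrier = {a..b}, eq = (=), le = (\<le>)\<rparr>"

datatype sentence =
    Atom nat
  | Conj sentence sentence
  | Disj sentence sentence
  | Impl sentence sentence
  | Neg sentence

text \<open>
  The operations below, like \<^const>\<open>meet\<close> and \<^const>\<open>join\<close>, are specified by the order of \<open>L\<close>
  alone, and are meaningful when \<open>L\<close> is an implicative lattice.
\<close>

definition rel_pseudocompl :: "'a gorder \<Rightarrow> 'a \<Rightarrow> 'a \<Rightarrow> 'a" where
  "rel_pseudocompl L a b = (THE c. greatest L c {c \<in> carrier L. a \<sqinter>\<^bsub>L\<^esub> c \<sqsubseteq>\<^bsub>L\<^esub> b})"

definition valuation :: "'a gorder \<Rightarrow> (sentence \<Rightarrow> 'a) \<Rightarrow> bool" where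
  "valuation L v \<longleftrightarrow>
     range v \<subseteq> carrier L \<and>
     (\<forall>\<phi> \<psi>. v (Conj \<phi> \<psi>) = v \<phi> \<sqinter>\<^bsub>L\<^esub> v \<psi>) \<and>
     (\<forall>\<phi> \<psi>. v (Disj \<phi> \<psi>) = v \<phi> \<squnion>\<^bsub>L\<^esub> v \<psi>) \<and>
     (\<forall>\<phi> \<psi>. v (Impl \<phi> \<psi>) = rel_pseudocompl L (v \<phi>) (v \<psi>)) \<and>
     (\<forall>\<phi>. v (Neg \<phi>) = rel_pseudocompl L (v \<phi>) \<bottom>\<^bsub>L\<^esub>)"

definition theory_of :: "'a gorder \<Rightarrow> sentence set" where
  "theory_of L = {\<phi>. \<forall>v. valuation L v \<longrightarrow> v \<phi> = \<top>\<^bsub>L\<^esub>}"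

definition dual_theory_of :: "'a gorder \<Rightarrow> sentence set" where
  "dual_theory_of L = theory_of (inv_gorder L)"

inductive intuitionistic_provable :: "sentence \<Rightarrow> bool" where
  impl_K: "intuitionistic_provable (Impl \<phi> (Impl \<psi> \<phi>))"
| impl_S: "intuitionistic_provable
    (Impl (Impl \<phi> (Impl \<psi> \<chi>)) (Impl (Impl \<phi> \<psi>) (Impl \<phi> \<chi>)))"
| conj_intro: "intuitionistic_provable (Impl \<phi> (Impl \<psi> (Conj \<phi> \<psi>)))"
| conj_elim1: "intuitionistic_provable (Impl (Conj \<phi> \<psi>) \<phi>)"
| conj_elim2: "intuitionistic_provable (Impl (Conj \<phi> \<psi>) \<psi>)"
| disj_intro1: "intuitionistic_provable (Impl \<phi> (Disj \<phi> \<psi>))"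
| disj_intro2: "intuitionistic_provable (Impl \<psi> (Disj \<phi> \<psi>))"
| disj_elim: "intuitionistic_provable
    (Impl (Impl \<phi> \<chi>) (Impl (Impl \<psi> \<chi>) (Impl (Disj \<phi> \<psi>) \<chi>)))"
| neg_intro: "intuitionistic_provable (Impl (Impl \<phi> \<psi>) (Impl (Impl \<phi> (Neg \<psi>)) (Neg \<phi>)))"
| neg_elim: "intuitionistic_provable (Impl (Neg \<phi>) (Impl \<phi> \<psi>))"
| modus_ponens: "intuitionistic_provable (Impl \<phi> \<psi>) \<Longrightarrow> intuitionistic_provable \<phi> \<Longrightarrow>
    intuitionistic_provable \<psi>"

definition IPC :: "sentence set" where
  "IPC = {\<phi>. intuitionistic_provable \<phi>}"

end

(*
  IPC is sound because D_s is dual-implicative: the least c with b <= a v c is the set of codes of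
  continuous reductions of b to a. Such a code lists the values determined by finite segments of the
  input, and it is computable uniformly in the parameters of a recursive functional.

  For the converse, take a Turing antichain x_v indexed by the vertices v of a graph and let a_F be the
  degree of the set of all f that are Turing reducible to no x_v with v in F. Then a_F v a_G is the
  degree of the union of F and G, and the least c with a_F <= a_G v c is the degree of the difference
  F - G; the latter extends to infinite sums of such degrees in place of a_F, summand by summand.
  The vertices are the worlds of countably many finite Kripke models, one refuting each unprovable
  sentence, with edges between comparable worlds of one model, and r is the infinite sum of the a_{u,v}
  over the nonedges {u,v}. In a fixed model, the finite meets of r and of degrees a_F of nonempty sets
  of worlds describe upward closed sets of nonempty chains ordered by inclusion. Sending a chain to its
  largest element is a p-morphism onto the model, so modulo the least of these finite meets the
  valuation computed in the initial segment is the forcing relation of the model.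
*)

theory Submission
  imports Defs "HOL-Library.Countable"
begin

hide_const (open) Lattice.sup Lattice.inf

subsection \<open>Total recursive functionals\<close>

text \<open>The degrees \<open>cone F\<close> obey only the calculus of sets, so the order of a
  model has to be encoded in the top element. A nonedge inside \<open>F\<close> puts
  \<open>cone F\<close> above \<open>bound\<close>, hence every set that is not a clique is
  collapsed into the top. A graph prescribes no more than its cliques, and the cliques that an order
  supplies are its chains; this is why chains are realised and a p-morphism is needed. One degree
  has to serve all models, so the sum over the nonedges is infinite and need not be the infimum of
  its summands. What replaces the infimum property is that a reduction to a sum commits to a summand
  after finitely much input. The price is interference: summands at nonedges that meet other models
  survive residuation by worlds of the given model. They lie above \<open>outside k\<close>, and as
  vertices of different models are never adjacent, \<open>outside k\<close> joined with the degree
  of any single world is above \<open>bound\<close>. The computation is therefore done modulo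
  \<open>base k\<close>, whose faces all belong to nonempty sets of worlds.\<close>

definition recursive_functional :: "((nat \<Rightarrow> nat) \<Rightarrow> nat \<Rightarrow> nat) \<Rightarrow> bool" where
  "recursive_functional F \<longleftrightarrow> partial_recursive_functional (\<lambda>g n. Some (F g n))"

named_theorems rf_intros

lemma rf_comp:
  assumes "recursive_functional F" "recursive_functional G"
  shows "recursive_functional (\<lambda>g n. F g (G g n))"
  using partial_recursive_functional.comp[OF assms(2,1)[unfolded recursive_functional_def]]
  by (simp add: recursive_functional_def)

text \<open>As \<open>G\<close> is total, the substitution lemma determines \<open>\<Theta>\<close>
  at every oracle, so the composite is itself partial recursive.\<close>

lemma prf_subst:
  assumes "partial_recursive_functional \<Phi>" "recursive_functional G"
  shows "partial_recursive_functional (\<lambda>g. \<Phi> (G g))"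
proof -
  obtain \<Theta> where \<Theta>: "partial_recursive_functional \<Theta>"
    "\<And>g f. \<forall>n. Some (G g n) = Some (f n) \<Longrightarrow> \<Theta> g = \<Phi> f"
    using partial_recursive_functional_subst assms unfolding recursive_functional_def by blast
  then have "\<Theta> = (\<lambda>g. \<Phi> (G g))" by (metis ext)
  with \<Theta>(1) show ?thesis by simp
qed

lemma rf_pair [rf_intros]:
  assumes "recursive_functional F" "recursive_functional G"
  shows "recursive_functional (\<lambda>g n. prod_encode (F g n, G g n))"
  using partial_recursive_functional.pair[OF assms[unfolded recursive_functional_def]]
  by (simp add: recursive_functional_def)

lemma rf_id [rf_intros]: "recursive_functional (\<lambda>g n. n)"
  using partial_recursive_functional.pair[OF partial_recursive_functional.left partial_recursive_functional.right]
  by (simp add: recursive_functional_def)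

lemma rf_Suc [rf_intros]:
  "recursive_functional F \<Longrightarrow> recursive_functional (\<lambda>g n. Suc (F g n))"
  using rf_comp[of "\<lambda>g n. Suc n" F] partial_recursive_functional.succ
  by (simp add: recursive_functional_def)

lemma rf_fst [rf_intros]:
  "recursive_functional F \<Longrightarrow> recursive_functional (\<lambda>g n. fst (prod_decode (F g n)))"
  using rf_comp[of "\<lambda>g n. fst (prod_decode n)" F] partial_recursive_functional.left
  by (simp add: recursive_functional_def)

lemma rf_snd [rf_intros]:
  "recursive_functional F \<Longrightarrow> recursive_functional (\<lambda>g n. snd (prod_decode (F g n)))"
  using rf_comp[of "\<lambda>g n. snd (prod_decode n)" F] partial_recursive_functional.right
  by (simp add: recursive_functional_def)

lemma rf_query [rf_intros]:
  "recursive_functional F \<Longrightarrow> recursive_functional (\<lambda>g n. g (F g n))"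
  using rf_comp[of "\<lambda>g n. g n" F] partial_recursive_functional.query
  by (simp add: recursive_functional_def)

lemma rf_const [rf_intros]: "recursive_functional (\<lambda>g n. c)"
proof (induction c)
  case 0
  show ?case using partial_recursive_functional.zero by (simp add: recursive_functional_def)
next
  case (Suc c)
  then show ?case by (rule rf_Suc)
qed

text \<open>The step may depend on \<open>n\<close>, so \<open>n\<close> is carried along as the
  parameter of the recursion by pairing it with the number of steps. Totality collapses the
  recursion on options to \<open>rec_nat\<close>.\<close>

lemma rf_rec:
  assumes "recursive_functional A" "recursive_functional N"
    and "recursive_functional (\<lambda>g m. B g (fst (prod_decode m)) (fst (prod_decode (snd (prod_decode m))))
      (snd (prod_decode (snd (prod_decode m)))))"
  shows "recursive_functional (\<lambda>g n. rec_nat (A g n) (B g n) (N g n))"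
proof -
  have *: "rec_nat (Some a) (\<lambda>y r. Option.bind r (\<lambda>v. Some (h y v))) k = Some (rec_nat a h k)"
    for a :: nat and h k
    by (induction k) auto
  have "recursive_functional (\<lambda>g m. rec_nat (A g (fst (prod_decode m)))
      (B g (fst (prod_decode m))) (snd (prod_decode m)))"
    using partial_recursive_functional.prec[OF assms(1,3)[unfolded recursive_functional_def]]
    by (simp add: recursive_functional_def *)
  from rf_comp[OF this rf_pair[OF rf_id assms(2)]] show ?thesis by simp
qed

lemma rf_if0 [rf_intros]:
  assumes "recursive_functional C" "recursive_functional A" "recursive_functional B"
  shows "recursive_functional (\<lambda>g n. if C g n = 0 then A g n else B g n)"
proof -
  have "recursive_functional (\<lambda>g n. rec_nat (A g n) ((\<lambda>g n y r. B g n) g n) (C g n))"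
    by (rule rf_rec) (intro assms rf_comp[OF assms(3)] rf_intros)+
  also have "(\<lambda>g n. rec_nat (A g n) ((\<lambda>g n y r. B g n) g n) (C g n)) =
      (\<lambda>g n. if C g n = 0 then A g n else B g n)"
    by (auto simp: fun_eq_iff gr0_conv_Suc)
  finally show ?thesis .
qed

lemma rf_pred:
  assumes "recursive_functional A"
  shows "recursive_functional (\<lambda>g n. A g n - 1)"
proof -
  have "recursive_functional (\<lambda>g n. rec_nat 0 ((\<lambda>g n y r. y) g n) (A g n))"
    by (rule rf_rec) (intro assms rf_intros)+
  also have "(\<lambda>g n. rec_nat 0 ((\<lambda>g n y r. y) g n) (A g n)) = (\<lambda>g n. A g n - 1)"
  proof (intro ext)
    fix g n show "rec_nat 0 ((\<lambda>g n y r. y) g n) (A g n) = A g n - 1"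
      by (cases "A g n") auto
  qed
  finally show ?thesis .
qed

lemma rf_diff [rf_intros]:
  assumes "recursive_functional A" "recursive_functional B"
  shows "recursive_functional (\<lambda>g n. A g n - B g n)"
proof -
  have *: "rec_nat a (\<lambda>y r. r - 1) k = a - k" for a k :: nat
    by (induction k) auto
  have "recursive_functional (\<lambda>g n. rec_nat (A g n) ((\<lambda>g n y r. r - 1) g n) (B g n))"
    by (rule rf_rec) (intro assms rf_intros rf_pred)+
  then show ?thesis by (simp add: *[unfolded One_nat_def])
qed

lemma rf_add_const [rf_intros]:
  "recursive_functional A \<Longrightarrow> recursive_functional (\<lambda>g n. A g n + c)"
  by (induction c) (auto intro: rf_Suc)

lemma rf_if_less [rf_intros]:
  assumes "recursive_functional C" "recursive_functional D" "recursive_functional A" "recursive_functional B"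
  shows "recursive_functional (\<lambda>g n. if C g n < D g n then A g n else B g n)"
proof -
  have "(\<lambda>g n. if C g n < D g n then A g n else B g n) =
      (\<lambda>g n. if D g n - C g n = 0 then B g n else A g n)"
    by (auto simp: fun_eq_iff)
  then show ?thesis using rf_if0[OF rf_diff[OF assms(2,1)] assms(4,3)] by simp
qed

lemma rf_if_eq [rf_intros]:
  assumes "recursive_functional C" "recursive_functional D" "recursive_functional A" "recursive_functional B"
  shows "recursive_functional (\<lambda>g n. if C g n = D g n then A g n else B g n)"
proof -
  have "(\<lambda>g n. if C g n = D g n then A g n else B g n) =
      (\<lambda>g n. if C g n < D g n then B g n else if D g n < C g n then B g n else A g n)"
    by (auto simp: fun_eq_iff)
  then show ?thesis using rf_if_less assms by simp
qed

lemma strong_leI: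
  assumes "recursive_functional F" "\<And>g. g \<in> Q \<Longrightarrow> F g \<in> P"
  shows "strong_le P Q"
  using assms unfolding strong_le_def recursive_functional_def by blast

text \<open>The least witness of a search is handed to \<open>V\<close> together with
  \<open>n\<close>. Totality of \<open>T\<close> and \<open>V\<close> leaves the absence of a
  witness as the only cause of divergence, and nothing is claimed in that case.\<close>

lemma prf_search:
  assumes T: "recursive_functional T" and V: "recursive_functional V"
  shows "\<exists>\<Psi>. partial_recursive_functional \<Psi> \<and> (\<forall>g n. (\<exists>s. T g (prod_encode (n, s)) = 0) \<longrightarrow>
    \<Psi> g n = Some (V g (prod_encode (n, LEAST s. T g (prod_encode (n, s)) = 0))))"
proof (intro exI conjI allI impI)
  note mu = partial_recursive_functional.mu[OF T[unfolded recursive_functional_def]]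
  note pr = partial_recursive_functional.pair[OF rf_id[unfolded recursive_functional_def] mu]
  show "partial_recursive_functional (\<lambda>g n. Option.bind
      (Option.bind (Some n) (\<lambda>a. Option.bind (minimize (\<lambda>m. Some (T g (prod_encode (n, m)))))
        (\<lambda>b. Some (prod_encode (a, b))))) (\<lambda>m. Some (V g m)))"
    by (rule partial_recursive_functional.comp[OF pr V[unfolded recursive_functional_def]])
qed (simp add: minimize_def)

subsection \<open>Finite approximations\<close>

definition fjoin :: "(nat \<Rightarrow> nat) \<Rightarrow> (nat \<Rightarrow> nat) \<Rightarrow> nat \<Rightarrow> nat" where
  "fjoin f g n = prod_encode (f n, g n)"

definition fleft :: "(nat \<Rightarrow> nat) \<Rightarrow> nat \<Rightarrow> nat" where
  "fleft h n = fst (prod_decode (h n))"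

definition fright :: "(nat \<Rightarrow> nat) \<Rightarrow> nat \<Rightarrow> nat" where
  "fright h n = snd (prod_decode (h n))"

lemma fleft_fjoin [simp]: "fleft (fjoin f g) = f"
  by (simp add: fleft_def fjoin_def fun_eq_iff)

lemma fright_fjoin [simp]: "fright (fjoin f g) = g"
  by (simp add: fright_def fjoin_def fun_eq_iff)

lemma fjoin_eq_iff [simp]: "fjoin f g = fjoin f' g' \<longleftrightarrow> f = f' \<and> g = g'"
  by (metis fleft_fjoin fright_fjoin)

lemma rf_fjoin:
  "recursive_functional F \<Longrightarrow> recursive_functional G \<Longrightarrow> recursive_functional (\<lambda>h. fjoin (F h) (G h))"
  unfolding fjoin_def by (intro rf_intros)

lemma rf_fleft: "recursive_functional F \<Longrightarrow> recursive_functional (\<lambda>h. fleft (F h))"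
  unfolding fleft_def by (intro rf_intros)

lemma rf_fright: "recursive_functional F \<Longrightarrow> recursive_functional (\<lambda>h. fright (F h))"
  unfolding fright_def by (intro rf_intros)

lemma rf_self: "recursive_functional (\<lambda>h. h)"
  using rf_query[OF rf_id] by simp

lemmas rf_fun = rf_fjoin rf_fleft rf_fright rf_self

fun pre :: "(nat \<Rightarrow> nat) \<Rightarrow> nat \<Rightarrow> nat" where
  "pre g 0 = 0"
| "pre g (Suc m) = prod_encode (g m, pre g m)"

definition initial_segment :: "(nat \<Rightarrow> nat) \<Rightarrow> nat \<Rightarrow> nat" where
  "initial_segment g m = prod_encode (m, pre g m)"

definition segment_length :: "nat \<Rightarrow> nat" where
  "segment_length s = fst (prod_decode s)"

text \<open>Values are stacked with the latest on top, so entry \<open>i\<close> is reached after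
  removing the \<open>segment_length s - Suc i\<close> entries above it.\<close>

definition segment_nth :: "nat \<Rightarrow> nat \<Rightarrow> nat" where
  "segment_nth s i = fst (prod_decode
     (rec_nat (snd (prod_decode s)) (\<lambda>_ r. snd (prod_decode r)) (segment_length s - Suc i)))"

lemma rf_initial_segment:
  assumes "recursive_functional G" "recursive_functional N"
  shows "recursive_functional (\<lambda>h n. initial_segment (G h) (N h n))"
proof -
  have *: "pre g k = rec_nat 0 (\<lambda>y r. prod_encode (g y, r)) k" for g k
    by (induction k) auto
  have "recursive_functional (\<lambda>h n. rec_nat 0 ((\<lambda>h n y r. prod_encode (G h y, r)) h n) (N h n))"
    by (rule rf_rec) (intro assms rf_intros rf_comp[OF assms(1)])+
  then show ?thesis
    unfolding initial_segment_def * by (intro rf_intros assms)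
qed

lemma rf_segment_length [rf_intros]:
  "recursive_functional F \<Longrightarrow> recursive_functional (\<lambda>h n. segment_length (F h n))"
  unfolding segment_length_def by (intro rf_intros)

lemma rf_segment_nth [rf_intros]:
  assumes "recursive_functional F" "recursive_functional G"
  shows "recursive_functional (\<lambda>h n. segment_nth (F h n) (G h n))"
proof -
  have "recursive_functional (\<lambda>h n. rec_nat (snd (prod_decode (F h n)))
      ((\<lambda>h n _ r. snd (prod_decode r)) h n) (segment_length (F h n) - Suc (G h n)))"
    by (rule rf_rec) (intro assms rf_intros)+
  then show ?thesis
    unfolding segment_nth_def by (intro rf_intros) simp
qed

lemma segment_length_initial [simp]: "segment_length (initial_segment g m) = m"
  by (simp add: segment_length_def initial_segment_def)

lemma segment_nth_initial:
  assumes "i < m"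
  shows "segment_nth (initial_segment g m) i = g i"
proof -
  have "rec_nat (pre g (d + k)) (\<lambda>_ r. snd (prod_decode r)) d = pre g k" for d k
    by (induction d arbitrary: k) (simp, metis add_Suc_shift old.nat.simps(7) pre.simps(2) prod_encode_inverse snd_conv)
  from this[of "m - Suc i" "Suc i"] assms show ?thesis
    by (simp add: segment_nth_def) (simp add: initial_segment_def)
qed

text \<open>Every number is the code of some segment, which lets a search run over all segments
  without a function at hand.\<close>

definition segment_of :: "nat \<Rightarrow> (nat \<Rightarrow> nat) \<Rightarrow> bool" where
  "segment_of s g \<longleftrightarrow> (\<forall>i<segment_length s. segment_nth s i = g i)"

lemma segment_of_initial: "segment_of (initial_segment g m) g"
  by (simp add: segment_of_def segment_nth_initial)

text \<open>Approximated values are shifted by one; the value \<open>0\<close> means that the segment does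
  not yet determine the result.\<close>

definition approximates ::
  "((nat \<Rightarrow> nat) \<Rightarrow> nat \<Rightarrow> nat) \<Rightarrow> ((nat \<Rightarrow> nat) \<Rightarrow> nat \<rightharpoonup> nat) \<Rightarrow> bool" where
  "approximates \<Theta> \<Phi> \<longleftrightarrow>
     (\<forall>f g s n v. segment_of s g \<longrightarrow> \<Theta> f (prod_encode (s, n)) = Suc v \<longrightarrow> \<Phi> (fjoin f g) n = Some v) \<and>
     (\<forall>f g n v. \<Phi> (fjoin f g) n = Some v \<longrightarrow>
        (\<forall>\<^sub>F m in sequentially. \<Theta> f (prod_encode (initial_segment g m, n)) = Suc v))"

lemma approximatesI:
  assumes "\<And>f g s n v. segment_of s g \<Longrightarrow> \<Theta> f (prod_encode (s, n)) = Suc v \<Longrightarrow> \<Phi> (fjoin f g) n = Some v"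
    and "\<And>f g n v. \<Phi> (fjoin f g) n = Some v \<Longrightarrow>
        \<forall>\<^sub>F m in sequentially. \<Theta> f (prod_encode (initial_segment g m, n)) = Suc v"
  shows "approximates \<Theta> \<Phi>"
  using assms unfolding approximates_def by blast

lemma approximates_sound:
  "approximates \<Theta> \<Phi> \<Longrightarrow> segment_of s g \<Longrightarrow> \<Theta> f (prod_encode (s, n)) = Suc v \<Longrightarrow> \<Phi> (fjoin f g) n = Some v"
  unfolding approximates_def by blast

lemma approximates_complete:
  "approximates \<Theta> \<Phi> \<Longrightarrow> \<Phi> (fjoin f g) n = Some v \<Longrightarrow>
     \<forall>\<^sub>F m in sequentially. \<Theta> f (prod_encode (initial_segment g m, n)) = Suc v"
  unfolding approximates_def by blast

text \<open>The recursion is repeated on shifted values: \<open>0\<close> propagates through the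
  remaining steps, and \<open>r - 1\<close> undoes the shift before a value is passed on.\<close>

lemma approximates_prec:
  assumes A: "approximates A \<Phi>" and B: "approximates B \<Psi>"
  shows "approximates (\<lambda>f m. rec_nat (A f (prod_encode (fst (prod_decode m), fst (prod_decode (snd (prod_decode m))))))
      (\<lambda>y r. if r = 0 then 0 else B f (prod_encode (fst (prod_decode m),
         prod_encode (fst (prod_decode (snd (prod_decode m))), prod_encode (y, r - 1)))))
      (snd (prod_decode (snd (prod_decode m)))))
    (\<lambda>g n. rec_nat (\<Phi> g (fst (prod_decode n)))
        (\<lambda>y r. Option.bind r
           (\<lambda>v. \<Psi> g (prod_encode (fst (prod_decode n), prod_encode (y, v)))))
        (snd (prod_decode n)))" (is "approximates ?T ?F")
proof (rule approximatesI)
  fix f g s n v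
  assume s: "segment_of s g" and T: "?T f (prod_encode (s, n)) = Suc v"
  obtain x k where n: "n = prod_encode (x, k)" by (metis prod_decode_inverse surj_pair)
  from T have "rec_nat (A f (prod_encode (s, x)))
      (\<lambda>y r. if r = 0 then 0 else B f (prod_encode (s, prod_encode (x, prod_encode (y, r - 1))))) k = Suc v"
    by (simp add: n cong: if_cong)
  then have "rec_nat (\<Phi> (fjoin f g) x) (\<lambda>y r. Option.bind r
           (\<lambda>v. \<Psi> (fjoin f g) (prod_encode (x, prod_encode (y, v))))) k = Some v"
  proof (induction k arbitrary: v)
    case 0
    then show ?case using approximates_sound[OF A s] by simp
  next
    case (Suc k)
    then show ?case using approximates_sound[OF B s] 
      by (auto split: if_splits simp: gr0_conv_Suc)
  qed
  then show "?F (fjoin f g) n = Some v" by (simp add: n)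
next
  fix f g n v
  assume F: "?F (fjoin f g) n = Some v"
  obtain x k where n: "n = prod_encode (x, k)" by (metis prod_decode_inverse surj_pair)
  from F have "rec_nat (\<Phi> (fjoin f g) x) (\<lambda>y r. Option.bind r
           (\<lambda>v. \<Psi> (fjoin f g) (prod_encode (x, prod_encode (y, v))))) k = Some v"
    by (simp add: n)
  then have "\<forall>\<^sub>F m in sequentially. rec_nat (A f (prod_encode (initial_segment g m, x)))
      (\<lambda>y r. if r = 0 then 0 else B f (prod_encode (initial_segment g m, prod_encode (x, prod_encode (y, r - 1))))) k = Suc v"
  proof (induction k arbitrary: v)
    case 0
    then show ?case using approximates_complete[OF A] by simp
  next
    case (Suc k)
    then obtain w where w: "rec_nat (\<Phi> (fjoin f g) x) (\<lambda>y r. Option.bind r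
           (\<lambda>v. \<Psi> (fjoin f g) (prod_encode (x, prod_encode (y, v))))) k = Some w"
       and v: "\<Psi> (fjoin f g) (prod_encode (x, prod_encode (k, w))) = Some v"
      by (auto simp: bind_eq_Some_conv)
    from Suc.IH[OF w] approximates_complete[OF B v] show ?case
      by eventually_elim simp
  qed
  then show "\<forall>\<^sub>F m in sequentially. ?T f (prod_encode (initial_segment g m, n)) = Suc v"
    by (simp add: n cong: if_cong)
qed

text \<open>The least \<open>k < m\<close> with \<open>q k < 2\<close>, and \<open>m\<close> if there is none. For approximated values \<open>q\<close>, this
  is where the search for a zero stops, at a value \<open>0\<close> or at an undetermined one.\<close>

definition bounded_search :: "(nat \<Rightarrow> nat) \<Rightarrow> nat \<Rightarrow> nat" where
  "bounded_search q = rec_nat 0 (\<lambda>y r. if r = y then if q y < 2 then r else Suc y else r)"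

lemma bounded_search:
  "bounded_search q m \<le> m \<and> (\<forall>k<bounded_search q m. q k > 1) \<and>
     (bounded_search q m < m \<longrightarrow> q (bounded_search q m) < 2)"
  unfolding bounded_search_def by (induction m) (auto simp: less_Suc_eq)

text \<open>The length of the segment also bounds the search. As the search may stop at an
  undetermined value or at the bound, success is granted only if the value found there is
  \<open>1\<close>, the shifted \<open>0\<close>.\<close>

lemma approximates_mu:
  assumes A: "approximates A \<Phi>"
  shows "approximates (\<lambda>f m. 
      if A f (prod_encode (fst (prod_decode m), prod_encode (snd (prod_decode m),
         bounded_search (\<lambda>y. A f (prod_encode (fst (prod_decode m), prod_encode (snd (prod_decode m), y))))
           (segment_length (fst (prod_decode m)))))) = 1
      then Suc (bounded_search (\<lambda>y. A f (prod_encode (fst (prod_decode m), prod_encode (snd (prod_decode m), y))))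
           (segment_length (fst (prod_decode m)))) else 0)
    (\<lambda>g n. minimize (\<lambda>m. \<Phi> g (prod_encode (n, m))))" (is "approximates ?T ?F")
proof (rule approximatesI)
  fix f g s n v
  assume s: "segment_of s g" and T: "?T f (prod_encode (s, n)) = Suc v"
  define q where "q = (\<lambda>y. A f (prod_encode (s, prod_encode (n, y))))"
  have v: "bounded_search q (segment_length s) = v" "q v = 1"
    using T by (auto simp: q_def split: if_splits)
  have q: "\<Phi> (fjoin f g) (prod_encode (n, y)) = Some w" if "q y = Suc w" for y w
    using approximates_sound[OF A s] that by (simp add: q_def)
  have 0: "\<Phi> (fjoin f g) (prod_encode (n, v)) = Some 0" using q v by simp
  have less: "\<exists>w. \<Phi> (fjoin f g) (prod_encode (n, k)) = Some (Suc w)" if "k < v" for k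
  proof -
    have "q k > 1" using bounded_search[of q "segment_length s"] v that by simp
    then obtain w where "q k = Suc (Suc w)" by (metis One_nat_def less_iff_Suc_add add_Suc)
    then show ?thesis using q by blast
  qed
  have "(LEAST m. \<Phi> (fjoin f g) (prod_encode (n, m)) = Some 0) = v"
    by (rule Least_equality, rule 0) (metis less nat.distinct(1) not_le option.inject)
  moreover have "\<exists>m. \<Phi> (fjoin f g) (prod_encode (n, m)) = Some 0 \<and>
      (\<forall>k<m. \<Phi> (fjoin f g) (prod_encode (n, k)) \<noteq> None)"
    using 0 less by (intro exI[of _ v]) auto
  ultimately show "?F (fjoin f g) n = Some v"
    unfolding minimize_def by simp
next
  fix f g n v
  assume F: "?F (fjoin f g) n = Some v"
  define h where "h = (\<lambda>m. \<Phi> (fjoin f g) (prod_encode (n, m)))"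
  have ex: "\<exists>m. h m = Some 0 \<and> (\<forall>k<m. h k \<noteq> None)" and v: "(LEAST m. h m = Some 0) = v"
    using F unfolding minimize_def h_def by (auto split: if_splits)
  then obtain m where m: "h m = Some 0" "\<forall>k<m. h k \<noteq> None" by blast
  have v0: "h v = Some 0" using LeastI[of "\<lambda>m. h m = Some 0" m] v m(1) by simp
  have "v \<le> m" using Least_le[of "\<lambda>m. h m = Some 0" m] v m(1) by simp
  have less: "\<exists>w. h k = Some (Suc w)" if "k < v" for k
  proof -
    have "h k \<noteq> None" using that m(2) \<open>v \<le> m\<close> by auto
    moreover have "h k \<noteq> Some 0" using that v not_less_Least[of k "\<lambda>m. h m = Some 0"] by simp
    ultimately show ?thesis by (metis not0_implies_Suc not_Some_eq)
  qed
  define q where "q = (\<lambda>m y. A f (prod_encode (initial_segment g m, prod_encode (n, y))))"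
  have ev: "\<forall>\<^sub>F m in sequentially. q m y = Suc w" if "h y = Some w" for y w
    using approximates_complete[OF A] that by (simp add: q_def h_def)
  have "\<forall>\<^sub>F m in sequentially. q m y > 1" if "y < v" for y
  proof -
    obtain w where "h y = Some (Suc w)" using less \<open>y < v\<close> by blast
    from ev[OF this] show ?thesis by eventually_elim simp
  qed
  \<comment> \<open>The finitely many values below \<open>v\<close> are all determined by one
    sufficiently long segment; the condition \<open>v < m\<close> below keeps the bound from cutting
    the search off.\<close>
  then have "\<forall>\<^sub>F m in sequentially. \<forall>y\<in>{..<v}. q m y > 1"
    by (intro eventually_ball_finite) auto
  moreover have "\<forall>\<^sub>F m in sequentially. q m v = 1" using ev[OF v0] by simp
  moreover have "\<forall>\<^sub>F m in sequentially. v < m" by (rule eventually_gt_at_top)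
  ultimately have "\<forall>\<^sub>F m in sequentially. q m (bounded_search (q m) m) = 1 \<and> bounded_search (q m) m = v"
  proof eventually_elim
    case (elim m)
    have "bounded_search (q m) m = v"
    proof (rule linorder_cases)
      assume "bounded_search (q m) m < v"
      moreover from this have "q m (bounded_search (q m) m) > 1" using elim(1) by simp
      ultimately show ?thesis using bounded_search[of "q m" m] elim(3) by simp
    next
      assume "v < bounded_search (q m) m"
      then show ?thesis using bounded_search[of "q m" m] elim(2) by auto
    qed
    with elim show ?case by simp
  qed
  then show "\<forall>\<^sub>F m in sequentially. ?T f (prod_encode (initial_segment g m, n)) = Suc v"
    by (rule eventually_mono) (auto simp: q_def)
qed

text \<open>Only \<open>g\<close> is replaced by segments; \<open>f\<close> stays available as a
  whole, so that one recursive \<open>\<Theta>\<close> serves all parameters \<open>f\<close>.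
  Correctness on all sufficiently long initial segments is the form that survives the induction,
  since finitely many such conditions hold jointly.\<close>

theorem approximation:
  assumes "partial_recursive_functional \<Phi>"
  shows "\<exists>\<Theta>. recursive_functional \<Theta> \<and> approximates \<Theta> \<Phi>"
  using assms
proof induction
  case query
  let ?T = "\<lambda>f m. if snd (prod_decode m) < segment_length (fst (prod_decode m))
    then Suc (prod_encode (f (snd (prod_decode m)), segment_nth (fst (prod_decode m)) (snd (prod_decode m)))) else 0"
  have "recursive_functional ?T" by (intro rf_intros)
  moreover have "approximates ?T (\<lambda>g n. Some (g n))"
  proof (rule approximatesI)
    fix f g n v assume "Some (fjoin f g n) = Some v"
    moreover have "\<forall>\<^sub>F m in sequentially. n < m" by (rule eventually_gt_at_top)
    ultimately show "\<forall>\<^sub>F m in sequentially. ?T f (prod_encode (initial_segment g m, n)) = Suc v"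
      by (auto elim!: eventually_mono simp: segment_nth_initial fjoin_def)
  qed (auto simp: segment_of_def fjoin_def split: if_splits)
  ultimately show ?case by blast
next
  case zero
  show ?case by (rule exI[of _ "\<lambda>f n. Suc 0"]) (auto simp: approximates_def intro: rf_intros)
next
  case succ
  show ?case by (rule exI[of _ "\<lambda>f n. Suc (Suc (snd (prod_decode n)))"])
    (auto simp: approximates_def intro!: rf_intros)
next
  case left
  show ?case by (rule exI[of _ "\<lambda>f n. Suc (fst (prod_decode (snd (prod_decode n))))"])
    (auto simp: approximates_def intro!: rf_intros)
next
  case right
  show ?case by (rule exI[of _ "\<lambda>f n. Suc (snd (prod_decode (snd (prod_decode n))))"])
    (auto simp: approximates_def intro!: rf_intros)
next
  case (pair \<Phi> \<Psi>)
  then obtain A B where rf: "recursive_functional A" "recursive_functional B"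
    and A: "approximates A \<Phi>" and B: "approximates B \<Psi>" by blast
  let ?T = "\<lambda>f m. if A f m = 0 then 0 else if B f m = 0 then 0 else Suc (prod_encode (A f m - 1, B f m - 1))"
  have "recursive_functional ?T" by (intro rf_intros rf)
  moreover have "approximates ?T (\<lambda>g n. Option.bind (\<Phi> g n) (\<lambda>a. Option.bind (\<Psi> g n) (\<lambda>b. Some (prod_encode (a, b)))))"
  proof (rule approximatesI)
    fix f g s n v
    assume s: "segment_of s g" and "?T f (prod_encode (s, n)) = Suc v"
    then obtain a b where "A f (prod_encode (s, n)) = Suc a" "B f (prod_encode (s, n)) = Suc b"
      "v = prod_encode (a, b)"
      by (auto split: if_splits simp: gr0_conv_Suc)
    then show "Option.bind (\<Phi> (fjoin f g) n) (\<lambda>a. Option.bind (\<Psi> (fjoin f g) n) (\<lambda>b. Some (prod_encode (a, b)))) = Some v"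
      using approximates_sound[OF A s] approximates_sound[OF B s] by simp
  next
    fix f g n v
    assume "Option.bind (\<Phi> (fjoin f g) n) (\<lambda>a. Option.bind (\<Psi> (fjoin f g) n) (\<lambda>b. Some (prod_encode (a, b)))) = Some v"
    then obtain a b where ab: "\<Phi> (fjoin f g) n = Some a" "\<Psi> (fjoin f g) n = Some b" and v: "v = prod_encode (a, b)"
      by (auto simp: bind_eq_Some_conv)
    from approximates_complete[OF A ab(1)] approximates_complete[OF B ab(2)]
    show "\<forall>\<^sub>F m in sequentially. ?T f (prod_encode (initial_segment g m, n)) = Suc v"
      by eventually_elim (simp add: v)
  qed
  ultimately show ?case by blast
next
  case (comp \<Phi> \<Psi>)
  then obtain A B where rf: "recursive_functional A" "recursive_functional B"
    and A: "approximates A \<Phi>" and B: "approximates B \<Psi>" by blast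
  let ?T = "\<lambda>f m. if A f m = 0 then 0 else B f (prod_encode (fst (prod_decode m), A f m - 1))"
  have "recursive_functional ?T" by (intro rf_intros rf rf_comp[OF rf(2)])
  moreover have "approximates ?T (\<lambda>g n. Option.bind (\<Phi> g n) (\<Psi> g))"
  proof (rule approximatesI)
    fix f g s n v
    assume s: "segment_of s g" and "?T f (prod_encode (s, n)) = Suc v"
    then obtain a where "A f (prod_encode (s, n)) = Suc a" "B f (prod_encode (s, a)) = Suc v"
      by (auto split: if_splits simp: gr0_conv_Suc)
    then show "Option.bind (\<Phi> (fjoin f g) n) (\<Psi> (fjoin f g)) = Some v"
      using approximates_sound[OF A s] approximates_sound[OF B s] by simp
  next
    fix f g n v
    assume "Option.bind (\<Phi> (fjoin f g) n) (\<Psi> (fjoin f g)) = Some v"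
    then obtain a where a: "\<Phi> (fjoin f g) n = Some a" "\<Psi> (fjoin f g) a = Some v"
      by (auto simp: bind_eq_Some_conv)
    from approximates_complete[OF A a(1)] approximates_complete[OF B a(2)]
    show "\<forall>\<^sub>F m in sequentially. ?T f (prod_encode (initial_segment g m, n)) = Suc v"
      by eventually_elim simp
  qed
  ultimately show ?case by blast
next
  case (prec \<Phi> \<Psi>)
  then obtain A B where rf: "recursive_functional A" "recursive_functional B"
    and A: "approximates A \<Phi>" and B: "approximates B \<Psi>" by blast
  have "recursive_functional (\<lambda>f m. rec_nat (A f (prod_encode (fst (prod_decode m), fst (prod_decode (snd (prod_decode m))))))
      ((\<lambda>f m y r. if r = 0 then 0 else B f (prod_encode (fst (prod_decode m),
         prod_encode (fst (prod_decode (snd (prod_decode m))), prod_encode (y, r - 1))))) f m)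
      (snd (prod_decode (snd (prod_decode m)))))"
    by (rule rf_rec, rule rf_comp[OF rf(1)]) (intro rf_intros rf_comp[OF rf(2)])+
  with approximates_prec[OF A B] show ?case by blast
next
  case (mu \<Phi>)
  then obtain A where rf: "recursive_functional A" and A: "approximates A \<Phi>" by blast
  let ?q = "\<lambda>f m y. A f (prod_encode (fst (prod_decode m), prod_encode (snd (prod_decode m), y)))"
  have "recursive_functional (\<lambda>f m. rec_nat 0 ((\<lambda>f m y r. if r = y then if ?q f m y < 2 then r else Suc y else r) f m)
      (segment_length (fst (prod_decode m))))"
    by (rule rf_rec) (intro rf_intros rf_comp[OF rf])+
  then have bs: "recursive_functional (\<lambda>f m. bounded_search (?q f m) (segment_length (fst (prod_decode m))))"
    unfolding bounded_search_def by simp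
  have "recursive_functional (\<lambda>f m.
      if A f (prod_encode (fst (prod_decode m), prod_encode (snd (prod_decode m),
         bounded_search (?q f m) (segment_length (fst (prod_decode m)))))) = 1
      then Suc (bounded_search (?q f m) (segment_length (fst (prod_decode m)))) else 0)"
    by (rule rf_if_eq, rule rf_comp[OF rf]) (intro bs rf_intros)+
  with approximates_mu[OF A] show ?case by blast
qed

subsection \<open>The lattice of strong degrees\<close>

definition mass_join :: "(nat \<Rightarrow> nat) set \<Rightarrow> (nat \<Rightarrow> nat) set \<Rightarrow> (nat \<Rightarrow> nat) set" where
  "mass_join P Q = {fjoin f g | f g. f \<in> P \<and> g \<in> Q}"

text \<open>The meet is the case of two summands; the infinite sum is a lower bound of the family,
  but in general not the greatest one.\<close>

definition mass_sum :: "nat set \<Rightarrow> (nat \<Rightarrow> (nat \<Rightarrow> nat) set) \<Rightarrow> (nat \<Rightarrow> nat) set" where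
  "mass_sum I P = {fjoin (\<lambda>_. i) f | i f. i \<in> I \<and> f \<in> P i}"

definition mass_meet :: "(nat \<Rightarrow> nat) set \<Rightarrow> (nat \<Rightarrow> nat) set \<Rightarrow> (nat \<Rightarrow> nat) set" where
  "mass_meet P Q = mass_sum {0, 1} (\<lambda>i. if i = 0 then P else Q)"

lemma strong_le_join1: "strong_le P (mass_join P Q)"
  by (rule strong_leI[of fleft]) (auto simp: mass_join_def intro: rf_fun)

lemma strong_le_join2: "strong_le Q (mass_join P Q)"
  by (rule strong_leI[of fright]) (auto simp: mass_join_def intro: rf_fun)

lemma mass_join_least:
  assumes "strong_le P R" "strong_le Q R"
  shows "strong_le (mass_join P Q) R"
proof -
  obtain \<Phi> where \<Phi>: "partial_recursive_functional \<Phi>" "\<And>g. g \<in> R \<Longrightarrow> \<exists>f\<in>P. \<forall>n. \<Phi> g n = Some (f n)"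
    using assms(1) unfolding strong_le_def by blast
  obtain \<Psi> where \<Psi>: "partial_recursive_functional \<Psi>" "\<And>g. g \<in> R \<Longrightarrow> \<exists>f\<in>Q. \<forall>n. \<Psi> g n = Some (f n)"
    using assms(2) unfolding strong_le_def by blast
  show ?thesis
    unfolding strong_le_def
  proof (intro exI conjI ballI)
    show "partial_recursive_functional (\<lambda>g n. Option.bind (\<Phi> g n) (\<lambda>a. Option.bind (\<Psi> g n) (\<lambda>b. Some (prod_encode (a, b)))))"
      by (rule partial_recursive_functional.pair[OF \<Phi>(1) \<Psi>(1)])
    fix g assume "g \<in> R"
    then obtain f f' where "f \<in> P" "f' \<in> Q" "\<forall>n. \<Phi> g n = Some (f n)" "\<forall>n. \<Psi> g n = Some (f' n)"
      using \<Phi>(2) \<Psi>(2) by metis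
    then show "\<exists>f\<in>mass_join P Q. \<forall>n. Option.bind (\<Phi> g n) (\<lambda>a. Option.bind (\<Psi> g n) (\<lambda>b. Some (prod_encode (a, b)))) = Some (f n)"
      by (intro bexI[of _ "fjoin f f'"]) (auto simp: fjoin_def mass_join_def)
  qed
qed

lemma mass_sum_le: "i \<in> I \<Longrightarrow> strong_le (mass_sum I P) (P i)"
  by (rule strong_leI[of "\<lambda>f. fjoin (\<lambda>_. i) f"]) (auto simp: mass_sum_def intro: rf_fun rf_const)

text \<open>Definition by cases for partial functionals: the branch not chosen may diverge, so
  evaluating both branches and selecting afterwards would be wrong.\<close>

lemma prf_if_eq:
  assumes C: "recursive_functional C" and \<Phi>: "partial_recursive_functional \<Phi>"
    and \<Psi>: "partial_recursive_functional \<Psi>"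
  shows "partial_recursive_functional (\<lambda>g n. if C g n = c then \<Phi> g n else \<Psi> g n)"
proof -
  \<comment> \<open>A recursion with no step or one step evaluates \<open>\<Phi>\<close> only if its branch is taken.\<close>
  have guard: "partial_recursive_functional (\<lambda>g n. if b g n = (0::nat) then Some 0 else \<Phi> g n)"
    if b: "recursive_functional b" "\<And>g n. b g n \<le> 1" and \<Phi>: "partial_recursive_functional \<Phi>" for b \<Phi>
  proof -
    have rec: "partial_recursive_functional (\<lambda>g m. rec_nat (Some 0)
        (\<lambda>y r. Option.bind r (\<lambda>v. \<Phi> g (fst (prod_decode m)))) (snd (prod_decode m)))"
      using partial_recursive_functional.prec[OF partial_recursive_functional.zero
         partial_recursive_functional.comp[OF partial_recursive_functional.left \<Phi>]] by simp
    have "recursive_functional (\<lambda>g n. prod_encode (n, b g n))" by (intro rf_intros b)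
    from partial_recursive_functional.comp[OF this[unfolded recursive_functional_def] rec]
    have "partial_recursive_functional (\<lambda>g n. rec_nat (Some 0) (\<lambda>y r. Option.bind r (\<lambda>v. \<Phi> g n)) (b g n))"
      by simp
    also have "(\<lambda>g n. rec_nat (Some 0) (\<lambda>y r. Option.bind r (\<lambda>v. \<Phi> g n)) (b g n)) =
        (\<lambda>g n. if b g n = 0 then Some 0 else \<Phi> g n)"
    proof (intro ext)
      fix g n
      have "b g n = 0 \<or> b g n = Suc 0" using b(2)[of g n] by auto
      then show "rec_nat (Some 0) (\<lambda>y r. Option.bind r (\<lambda>v. \<Phi> g n)) (b g n) =
          (if b g n = 0 then Some 0 else \<Phi> g n)"
        by auto
    qed
    finally show ?thesis .
  qed
  let ?b = "\<lambda>g n. if C g n = c then 1 else 0" and ?b' = "\<lambda>g n. if C g n = c then 0 else 1"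
  have 1: "partial_recursive_functional (\<lambda>g n. if ?b g n = (0::nat) then Some 0 else \<Phi> g n)"
    by (rule guard[OF _ _ \<Phi>]) (auto intro: rf_intros C)
  have 2: "partial_recursive_functional (\<lambda>g n. if ?b' g n = (0::nat) then Some 0 else \<Psi> g n)"
    by (rule guard[OF _ _ \<Psi>]) (auto intro: rf_intros C)
  have b: "recursive_functional ?b" by (intro rf_intros C)
  \<comment> \<open>The branch not taken now contributes the dummy value \<open>0\<close>, and the
    flag in the first component picks the other value.\<close>
  have "recursive_functional (\<lambda>g m. if fst (prod_decode m) = 0
      then snd (prod_decode (snd (prod_decode m))) else fst (prod_decode (snd (prod_decode m))))"
    by (intro rf_intros)
  note 3 = partial_recursive_functional.comp[OF
      partial_recursive_functional.pair[OF b[unfolded recursive_functional_def]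
        partial_recursive_functional.pair[OF 1 2]] this[unfolded recursive_functional_def]]
  show ?thesis
    by (rule back_subst[of partial_recursive_functional, OF 3])
      (auto simp: fun_eq_iff bind_eq_Some_conv split: Option.bind_split)
qed

lemma mass_meet_iff:
  "h \<in> mass_meet P Q \<longleftrightarrow> (\<exists>f\<in>P. h = fjoin (\<lambda>_. 0) f) \<or> (\<exists>f\<in>Q. h = fjoin (\<lambda>_. 1) f)"
  by (auto simp: mass_meet_def mass_sum_def)

text \<open>The tag can be read at argument \<open>0\<close> of the input and selects which of the
  two reductions is run on the untagged part.\<close>

lemma mass_meet_greatest:
  assumes "strong_le R P" "strong_le R Q"
  shows "strong_le R (mass_meet P Q)"
proof -
  obtain \<Phi> where \<Phi>: "partial_recursive_functional \<Phi>" "\<And>g. g \<in> P \<Longrightarrow> \<exists>f\<in>R. \<forall>n. \<Phi> g n = Some (f n)"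
    using assms(1) unfolding strong_le_def by blast
  obtain \<Psi> where \<Psi>: "partial_recursive_functional \<Psi>" "\<And>g. g \<in> Q \<Longrightarrow> \<exists>f\<in>R. \<forall>n. \<Psi> g n = Some (f n)"
    using assms(2) unfolding strong_le_def by blast
  have fr: "recursive_functional fright" using rf_fright[OF rf_self] .
  have "recursive_functional (\<lambda>h n. fst (prod_decode (h 0)))" by (intro rf_intros)
  note \<Theta> = prf_if_eq[OF this prf_subst[OF \<Phi>(1) fr] prf_subst[OF \<Psi>(1) fr], of 0]
  have "\<exists>f\<in>R. \<forall>n. (if fst (prod_decode (h 0)) = 0 then \<Phi> (fright h) n else \<Psi> (fright h) n) = Some (f n)"
    if h: "h \<in> mass_meet P Q" for h
  proof -
    consider f where "h = fjoin (\<lambda>_. 0) f" "f \<in> P" | f where "h = fjoin (\<lambda>_. 1) f" "f \<in> Q"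
      using h unfolding mass_meet_iff by blast
    then show ?thesis
    proof cases
      case 1
      then show ?thesis using \<Phi>(2)[of f] by (simp add: fjoin_def[of _ _ 0])
    next
      case 2
      then show ?thesis using \<Psi>(2)[of f] by (simp add: fjoin_def[of _ _ 0])
    qed
  qed
  with \<Theta> show ?thesis unfolding strong_le_def by blast
qed

lemma mass_meet_le1: "strong_le (mass_meet P Q) P"
  unfolding mass_meet_def using mass_sum_le[of 0 "{0, 1}" "\<lambda>i. if i = 0 then P else Q"] by simp

lemma mass_meet_le2: "strong_le (mass_meet P Q) Q"
  unfolding mass_meet_def using mass_sum_le[of 1 "{0, 1}" "\<lambda>i. if i = 0 then P else Q"] by simp

instantiation strong_degree :: distrib_lattice
begin

lift_definition sup_strong_degree :: "strong_degree \<Rightarrow> strong_degree \<Rightarrow> strong_degree" is mass_join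
  unfolding strong_equiv_def
  by (meson mass_join_least strong_le_join1 strong_le_join2 strong_le_trans)

lift_definition inf_strong_degree :: "strong_degree \<Rightarrow> strong_degree \<Rightarrow> strong_degree" is mass_meet
  unfolding strong_equiv_def
  by (meson mass_meet_greatest mass_meet_le1 mass_meet_le2 strong_le_trans)

instance
proof
  fix x y z :: strong_degree
  show le: "inf x y \<le> x" "inf x y \<le> y" for x y :: strong_degree
    by (transfer, rule mass_meet_le1) (transfer, rule mass_meet_le2)
  show ge: "x \<le> sup x y" "y \<le> sup x y" for x y :: strong_degree
    by (transfer, rule strong_le_join1) (transfer, rule strong_le_join2)
  show greatest: "x \<le> y \<Longrightarrow> x \<le> z \<Longrightarrow> x \<le> inf y z" for x y z :: strong_degree
    by transfer (rule mass_meet_greatest)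
  show least: "y \<le> x \<Longrightarrow> z \<le> x \<Longrightarrow> sup y z \<le> x" for x y z :: strong_degree
    by transfer (rule mass_join_least)
  \<comment> \<open>Only the tag has to move: \<open>f\<close> and a tagged \<open>g\<close> are
    turned into the tagged pair of \<open>f\<close> and \<open>g\<close>.\<close>
  have "inf (sup x y) (sup x z) \<le> sup x (inf y z)"
  proof transfer
    fix P Q R
    have F: "recursive_functional (\<lambda>h. fjoin (fleft (fright h)) (fjoin (fleft h) (fright (fright h))))"
      by (intro rf_fun)
    show "strong_le (mass_meet (mass_join P Q) (mass_join P R)) (mass_join P (mass_meet Q R))"
      by (rule strong_leI[OF F]) (unfold mass_meet_iff mass_join_def, auto simp: mass_meet_iff)
  qed
  moreover have "sup x (inf y z) \<le> inf (sup x y) (sup x z)"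
    by (meson ge greatest le least order_trans)
  ultimately show "sup x (inf y z) = inf (sup x y) (sup x z)" by (rule antisym[rotated])
qed

end

text \<open>A reduction with a fixed parameter is partial, while a code has to be a total function.
  A table over pairs of a segment and an argument resolves this, with \<open>0\<close> for
  undetermined and \<open>Suc v\<close> for the value \<open>v\<close>; \<open>Ap\<close> consults
  it along longer and longer segments of \<open>g\<close>.\<close>

lemma mass_implication_exists:
  "\<exists>R. \<forall>S. strong_le R S \<longleftrightarrow> strong_le Q (mass_join P S)"
proof -
  let ?T = "\<lambda>h m. if fleft h (prod_encode (initial_segment (fright h) (snd (prod_decode m)), fst (prod_decode m))) = 0
    then 1 else (0::nat)"
  let ?V = "\<lambda>h m. fleft h (prod_encode (initial_segment (fright h) (snd (prod_decode m)), fst (prod_decode m))) - 1"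
  have q: "recursive_functional (\<lambda>h m. fleft h (prod_encode (initial_segment (fright h) (snd (prod_decode m)), fst (prod_decode m))))"
    by (rule rf_comp[OF rf_fleft[OF rf_self]]) (intro rf_intros rf_fun rf_initial_segment)
  have T: "recursive_functional ?T" and V: "recursive_functional ?V" by (intro rf_intros q)+
  obtain Ap where Ap: "partial_recursive_functional Ap"
    and Ap_eq': "\<And>g n. \<exists>s. ?T g (prod_encode (n, s)) = 0 \<Longrightarrow>
      Ap g n = Some (?V g (prod_encode (n, LEAST s. ?T g (prod_encode (n, s)) = 0)))"
    using prf_search[OF T V] by blast
  have T0: "?T (fjoin \<alpha> g) (prod_encode (n, s)) = 0 \<longleftrightarrow> \<alpha> (prod_encode (initial_segment g s, n)) \<noteq> 0" for \<alpha> g n s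
    by simp
  have Ap_eq: "Ap (fjoin \<alpha> g) n = Some (\<alpha> (prod_encode (initial_segment g
        (LEAST m. \<alpha> (prod_encode (initial_segment g m, n)) \<noteq> 0), n)) - 1)"
    if "\<exists>m. \<alpha> (prod_encode (initial_segment g m, n)) \<noteq> 0" for \<alpha> g n
    using Ap_eq'[of "fjoin \<alpha> g" n, unfolded T0, OF that]
    by (simp only: fleft_fjoin fright_fjoin prod_encode_inverse fst_conv snd_conv)
  \<comment> \<open>A code has to succeed on \<open>P\<close> only; on other functions
    \<open>Ap\<close> may diverge.\<close>
  define R where "R = {\<alpha>. \<forall>g\<in>P. \<exists>q\<in>Q. \<forall>n. Ap (fjoin \<alpha> g) n = Some (q n)}"
  have swap: "recursive_functional (\<lambda>h. fjoin (fright h) (fleft h))" by (intro rf_fun)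
  have "strong_le Q (mass_join P R)"
    unfolding strong_le_def
    by (intro exI conjI, rule prf_subst[OF Ap swap]) (auto simp: mass_join_def R_def)
  moreover have "strong_le R S" if "strong_le Q (mass_join P S)" for S
  proof -
    obtain \<Phi> where \<Phi>: "partial_recursive_functional \<Phi>"
      "\<And>g. g \<in> mass_join P S \<Longrightarrow> \<exists>f\<in>Q. \<forall>n. \<Phi> g n = Some (f n)"
      using \<open>strong_le Q (mass_join P S)\<close> unfolding strong_le_def by blast
    obtain \<Theta> where \<Theta>: "recursive_functional \<Theta>" "approximates \<Theta> (\<lambda>h. \<Phi> (fjoin (fright h) (fleft h)))"
      using approximation[OF prf_subst[OF \<Phi>(1) swap]] by blast
    have "\<Theta> f \<in> R" if "f \<in> S" for f
      unfolding R_def mem_Collect_eq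
    proof
      fix g assume "g \<in> P"
      with \<Phi>(2) \<open>f \<in> S\<close> obtain q where q: "q \<in> Q" "\<And>n. \<Phi> (fjoin g f) n = Some (q n)"
        unfolding mass_join_def by blast
      have "Ap (fjoin (\<Theta> f) g) n = Some (q n)" for n
      proof -
        have ex: "\<exists>m. \<Theta> f (prod_encode (initial_segment g m, n)) \<noteq> 0"
          using eventually_happens'[OF sequentially_bot approximates_complete[OF \<Theta>(2), of f g n "q n"]] q(2)
          by (metis fleft_fjoin fright_fjoin nat.distinct(1))
        define m where "m = (LEAST m. \<Theta> f (prod_encode (initial_segment g m, n)) \<noteq> 0)"
        have "\<Theta> f (prod_encode (initial_segment g m, n)) \<noteq> 0"
          unfolding m_def by (rule LeastI_ex[OF ex])
        then obtain v where v: "\<Theta> f (prod_encode (initial_segment g m, n)) = Suc v"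
          by (metis not0_implies_Suc)
        \<comment> \<open>Completeness concerns long segments, but \<open>Ap\<close> stops at the
          first nonzero entry; soundness makes that entry correct as well.\<close>
        have "v = q n" using approximates_sound[OF \<Theta>(2), OF segment_of_initial v] q(2) by simp
        with v Ap_eq[OF ex, folded m_def] show ?thesis by simp
      qed
      with q(1) show "\<exists>q\<in>Q. \<forall>n. Ap (fjoin (\<Theta> f) g) n = Some (q n)" by blast
    qed
    then show ?thesis by (rule strong_leI[OF \<Theta>(1)])
  qed
  moreover have "strong_le Q (mass_join P S)" if "strong_le Q (mass_join P R)" "strong_le R S" for S
    using that by (meson mass_join_least strong_le_join1 strong_le_join2 strong_le_trans)
  ultimately show ?thesis by blast
qed

text \<open>The difference of a co-Heyting algebra, \<open>b\<close> minus \<open>a\<close>. In the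
  dual lattice it is the implication from \<open>a\<close> to \<open>b\<close>, hence the order of
  the arguments.\<close>

definition dimp :: "strong_degree \<Rightarrow> strong_degree \<Rightarrow> strong_degree" where
  "dimp a b = (SOME c. \<forall>d. c \<le> d \<longleftrightarrow> b \<le> sup a d)"

lemma dimp_le_iff: "dimp a b \<le> d \<longleftrightarrow> b \<le> sup a d"
proof -
  have "\<exists>c. \<forall>d. c \<le> d \<longleftrightarrow> b \<le> sup a d"
    by transfer (rule mass_implication_exists)
  from someI_ex[OF this] show ?thesis unfolding dimp_def by blast
qed

subsection \<open>Valuations in the dual of an initial segment\<close>

lemma dual_interval_top:
  fixes r :: strong_degree
  shows "\<top>\<^bsub>inv_gorder (interval_order bot r)\<^esub> = bot"
  unfolding Order.top_def by (rule some_equality) (auto simp: greatest_def interval_order_def intro: antisym)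

lemma dual_interval_bottom:
  fixes r :: strong_degree
  shows "\<bottom>\<^bsub>inv_gorder (interval_order bot r)\<^esub> = r"
  unfolding Order.bottom_def by (rule some_equality) (auto simp: least_def interval_order_def intro: antisym)

lemma dual_interval_meet:
  fixes r :: strong_degree
  assumes "x \<le> r" "y \<le> r"
  shows "x \<sqinter>\<^bsub>inv_gorder (interval_order bot r)\<^esub> y = sup x y"
  unfolding meet_def Lattice.inf_def
  by (rule some_equality)
    (use assms in \<open>auto simp: greatest_def Lower_def interval_order_def intro: antisym\<close>)

lemma dual_interval_join:
  fixes r :: strong_degree
  assumes "x \<le> r" "y \<le> r"
  shows "x \<squnion>\<^bsub>inv_gorder (interval_order bot r)\<^esub> y = inf x y"
proof -
  let ?L = "inv_gorder (interval_order bot r)"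
  have least: "least ?L (inf x y) (Upper ?L {x, y})"
    using assms by (auto simp: least_def Upper_def interval_order_def intro: le_infI1)
  have "z = inf x y" if "least ?L z (Upper ?L {x, y})" for z
  proof (rule antisym)
    show "z \<le> inf x y" using that assms by (auto simp: least_def Upper_def interval_order_def)
    show "inf x y \<le> z" using that least by (auto simp: least_def interval_order_def)
  qed
  with least show ?thesis
    unfolding join_def Lattice.sup_def by (rule some_equality)
qed

lemma dimp_le: "dimp a b \<le> b"
  by (simp add: dimp_le_iff)

text \<open>As \<open>dimp a b\<close> is at most \<open>b\<close>, it already lies in the interval,
  and restricting the lattice does not change the operation.\<close>

lemma dual_interval_pseudocompl:
  fixes r :: strong_degree
  assumes "a \<le> r" "b \<le> r"
  shows "rel_pseudocompl (inv_gorder (interval_order bot r)) a b = dimp a b"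
proof -
  let ?L = "inv_gorder (interval_order bot r)"
  have "c \<in> carrier ?L \<and> a \<sqinter>\<^bsub>?L\<^esub> c \<sqsubseteq>\<^bsub>?L\<^esub> b \<longleftrightarrow> c \<le> r \<and> dimp a b \<le> c" for c
  proof (cases "c \<le> r")
    case True
    show ?thesis
      unfolding dual_interval_meet[OF assms(1) True] dimp_le_iff by (simp add: interval_order_def True)
  qed (simp add: interval_order_def)
  then have "{c \<in> carrier ?L. a \<sqinter>\<^bsub>?L\<^esub> c \<sqsubseteq>\<^bsub>?L\<^esub> b} = {c. c \<le> r \<and> dimp a b \<le> c}"
    by (intro Collect_cong)
  moreover have "dimp a b \<le> r"
    using dimp_le assms(2) by (rule order_trans)
  ultimately show ?thesis
    unfolding rel_pseudocompl_def
    by (auto intro!: the_equality simp: greatest_def) (auto simp: interval_order_def intro: antisym)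
qed

text \<open>The range condition is settled before the others: below \<open>r\<close>, the operations
  of the interval agree with those on all degrees.\<close>

lemma valuation_dual_interval:
  fixes r :: strong_degree
  shows "valuation (inv_gorder (interval_order bot r)) v \<longleftrightarrow>
    (\<forall>\<phi>. v \<phi> \<le> r) \<and>
    (\<forall>\<phi> \<psi>. v (Conj \<phi> \<psi>) = sup (v \<phi>) (v \<psi>)) \<and>
    (\<forall>\<phi> \<psi>. v (Disj \<phi> \<psi>) = inf (v \<phi>) (v \<psi>)) \<and>
    (\<forall>\<phi> \<psi>. v (Impl \<phi> \<psi>) = dimp (v \<phi>) (v \<psi>)) \<and>
    (\<forall>\<phi>. v (Neg \<phi>) = dimp (v \<phi>) r)"
proof -
  have "range v \<subseteq> carrier (inv_gorder (interval_order bot r)) \<longleftrightarrow> (\<forall>\<phi>. v \<phi> \<le> r)"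
    by (simp add: interval_order_def image_subset_iff)
  note range = this
  show ?thesis
  proof (cases "\<forall>\<phi>. v \<phi> \<le> r")
    case True
    then have le: "v \<phi> \<le> r" for \<phi> by simp
    show ?thesis
      unfolding valuation_def dual_interval_bottom range
      by (simp only: dual_interval_meet dual_interval_join dual_interval_pseudocompl le order_refl)
  next
    case False
    then show ?thesis unfolding valuation_def range by blast
  qed
qed

lemma dual_theory_of_initial_segment:
  fixes r :: strong_degree
  shows "dual_theory_of (interval_order bot r) =
    {\<phi>. \<forall>v. valuation (inv_gorder (interval_order bot r)) v \<longrightarrow> v \<phi> = bot}"
  unfolding dual_theory_of_def theory_of_def dual_interval_top ..

lemma dimp_self: "b \<le> sup a (dimp a b)"
  using dimp_le_iff by blast

text \<open>Truth in the dual is \<open>bot\<close>, and \<open>dimp a b\<close> is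
  \<open>bot\<close> iff \<open>b\<close> is at most \<open>a\<close>. Residuation then turns each
  axiom into an inequality between degrees.\<close>

lemma IPC_sound:
  fixes r :: strong_degree
  assumes "intuitionistic_provable \<phi>" "valuation (inv_gorder (interval_order bot r)) v"
  shows "v \<phi> = bot"
  using assms(1)
proof induction
  have v: "v \<phi> \<le> r" "v (Conj \<phi> \<psi>) = sup (v \<phi>) (v \<psi>)" "v (Disj \<phi> \<psi>) = inf (v \<phi>) (v \<psi>)"
    "v (Impl \<phi> \<psi>) = dimp (v \<phi>) (v \<psi>)" "v (Neg \<phi>) = dimp (v \<phi>) r" for \<phi> \<psi>
    using assms(2) unfolding valuation_dual_interval by auto
  have bot: "dimp a b = bot \<longleftrightarrow> b \<le> a" for a b
    using dimp_le_iff[of a b bot] by (simp add: bot_unique sup_absorb1)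
  {
    case (impl_K \<phi> \<psi>)
    show ?case by (simp add: v bot dimp_le_iff)
  next
    case (impl_S \<phi> \<psi> \<chi>)
    \<comment> \<open>The join of all three antecedents; once the conclusion is below it,
      residuation peels them off one at a time.\<close>
    let ?x = "sup (v \<phi>) (sup (dimp (v \<phi>) (v \<psi>)) (dimp (v \<phi>) (dimp (v \<psi>) (v \<chi>))))"
    have "v \<psi> \<le> ?x" "dimp (v \<psi>) (v \<chi>) \<le> ?x"
      using dimp_self by (meson le_sup_iff order_refl order_trans sup.cobounded1 sup.cobounded2 sup_mono)+
    then have "v \<chi> \<le> ?x"
      using dimp_self[of "v \<chi>" "v \<psi>"] by (meson le_sup_iff order_trans)
    then show ?case by (simp add: v bot dimp_le_iff sup.commute sup.left_commute)
  next
    case (conj_intro \<phi> \<psi>)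
    show ?case by (simp add: v bot dimp_le_iff)
  next
    case (conj_elim1 \<phi> \<psi>)
    show ?case by (simp add: v bot)
  next
    case (conj_elim2 \<phi> \<psi>)
    show ?case by (simp add: v bot)
  next
    case (disj_intro1 \<phi> \<psi>)
    show ?case by (simp add: v bot)
  next
    case (disj_intro2 \<psi> \<phi>)
    show ?case by (simp add: v bot)
  next
    case (disj_elim \<phi> \<chi> \<psi>)
    have "v \<chi> \<le> sup (inf (v \<phi>) (v \<psi>)) (sup (dimp (v \<phi>) (v \<chi>)) (dimp (v \<psi>) (v \<chi>)))"
      using dimp_self[of "v \<chi>" "v \<phi>"] dimp_self[of "v \<chi>" "v \<psi>"]
      by (simp add: sup_inf_distrib2) (meson le_sup_iff order_refl order_trans sup.cobounded1 sup.cobounded2 sup_mono)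
    then show ?case by (simp add: v bot dimp_le_iff sup.commute sup.left_commute)
  next
    case (neg_intro \<phi> \<psi>)
    let ?x = "sup (v \<phi>) (sup (dimp (v \<phi>) (v \<psi>)) (dimp (v \<phi>) (dimp (v \<psi>) r)))"
    have "v \<psi> \<le> ?x" "dimp (v \<psi>) r \<le> ?x"
      using dimp_self by (meson le_sup_iff order_refl order_trans sup.cobounded1 sup.cobounded2 sup_mono)+
    then have "r \<le> ?x"
      using dimp_self[of r "v \<psi>"] by (meson le_sup_iff order_trans)
    then show ?case by (simp add: v bot dimp_le_iff sup.commute sup.left_commute)
  next
    case (neg_elim \<phi> \<psi>)
    have "v \<psi> \<le> sup (v \<phi>) (dimp (v \<phi>) r)"
      using v(1) dimp_self by (rule order_trans)
    then show ?case by (simp add: v bot dimp_le_iff)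
  next
    case (modus_ponens \<phi> \<psi>)
    then show ?case by (simp add: v bot bot_unique)
  }
qed

subsection \<open>Kripke completeness\<close>

inductive derives :: "sentence set \<Rightarrow> sentence \<Rightarrow> bool" for \<Gamma> where
  hyp: "\<phi> \<in> \<Gamma> \<Longrightarrow> derives \<Gamma> \<phi>"
| ax: "intuitionistic_provable \<phi> \<Longrightarrow> derives \<Gamma> \<phi>"
| mp: "derives \<Gamma> (Impl \<phi> \<psi>) \<Longrightarrow> derives \<Gamma> \<phi> \<Longrightarrow> derives \<Gamma> \<psi>"

lemma derives_refl: "derives \<Gamma> (Impl \<phi> \<phi>)"
  by (metis derives.ax impl_K impl_S modus_ponens)

lemma derives_empty: "derives {} \<phi> \<Longrightarrow> intuitionistic_provable \<phi>"
  by (induction rule: derives.induct) (auto intro: modus_ponens)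

lemma deduction:
  assumes "derives (insert \<phi> \<Gamma>) \<psi>"
  shows "derives \<Gamma> (Impl \<phi> \<psi>)"
  using assms
proof (induction rule: derives.induct)
  case (hyp \<psi>)
  then show ?case
    using derives_refl by (auto intro: derives.mp[OF derives.ax[OF impl_K] derives.hyp])
next
  case (ax \<psi>)
  then show ?case by (auto intro: derives.mp[OF derives.ax[OF impl_K] derives.ax])
next
  case (mp \<psi> \<chi>)
  then show ?case by (blast intro: derives.mp derives.ax[OF impl_S])
qed

lemma derives_cut: "derives (insert \<phi> \<Gamma>) \<psi> \<Longrightarrow> derives \<Gamma> \<phi> \<Longrightarrow> derives \<Gamma> \<psi>"
  by (blast intro: deduction derives.mp)

fun subsentences :: "sentence \<Rightarrow> sentence set" where
  "subsentences (Atom p) = {Atom p}"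
| "subsentences (Conj \<phi> \<psi>) = insert (Conj \<phi> \<psi>) (subsentences \<phi> \<union> subsentences \<psi>)"
| "subsentences (Disj \<phi> \<psi>) = insert (Disj \<phi> \<psi>) (subsentences \<phi> \<union> subsentences \<psi>)"
| "subsentences (Impl \<phi> \<psi>) = insert (Impl \<phi> \<psi>) (subsentences \<phi> \<union> subsentences \<psi>)"
| "subsentences (Neg \<phi>) = insert (Neg \<phi>) (subsentences \<phi>)"

lemma finite_subsentences: "finite (subsentences \<phi>)"
  by (induction \<phi>) auto

lemma subsentences_self: "\<phi> \<in> subsentences \<phi>"
  by (cases \<phi>) auto

lemma subsentences_closed:
  "Conj \<phi> \<psi> \<in> subsentences \<chi> \<Longrightarrow> \<phi> \<in> subsentences \<chi> \<and> \<psi> \<in> subsentences \<chi>"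
  "Disj \<phi> \<psi> \<in> subsentences \<chi> \<Longrightarrow> \<phi> \<in> subsentences \<chi> \<and> \<psi> \<in> subsentences \<chi>"
  "Impl \<phi> \<psi> \<in> subsentences \<chi> \<Longrightarrow> \<phi> \<in> subsentences \<chi> \<and> \<psi> \<in> subsentences \<chi>"
  "Neg \<phi> \<in> subsentences \<chi> \<Longrightarrow> \<phi> \<in> subsentences \<chi>"
  by (induction \<chi>) (auto simp: subsentences_self)

text \<open>Closure is demanded only within \<open>S\<close>, so that finitely many sentences give a
  finite canonical model. The last condition is consistency.\<close>

definition prime_theory :: "sentence set \<Rightarrow> sentence set \<Rightarrow> bool" where
  "prime_theory S \<Gamma> \<longleftrightarrow> \<Gamma> \<subseteq> S \<and> (\<forall>\<psi>\<in>S. derives \<Gamma> \<psi> \<longrightarrow> \<psi> \<in> \<Gamma>) \<and>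
     (\<forall>\<psi> \<chi>. Disj \<psi> \<chi> \<in> \<Gamma> \<longrightarrow> \<psi> \<in> \<Gamma> \<or> \<chi> \<in> \<Gamma>) \<and> (\<exists>\<chi>. \<not> derives \<Gamma> \<chi>)"

text \<open>\<open>\<Delta>\<close> is maximal among the subsets of \<open>S\<close> that do not
  derive \<open>\<theta>\<close>. Each further member of \<open>S\<close> would yield
  \<open>\<theta>\<close>, which gives closure by cut and primeness by
  \<open>disj_elim\<close>.\<close>

lemma prime_theory_extension:
  assumes S: "finite S" "\<And>\<psi> \<chi>. Disj \<psi> \<chi> \<in> S \<Longrightarrow> \<psi> \<in> S \<and> \<chi> \<in> S"
    and \<Gamma>: "\<Gamma> \<subseteq> S" "\<not> derives \<Gamma> \<theta>"
  shows "\<exists>\<Delta>. prime_theory S \<Delta> \<and> \<Gamma> \<subseteq> \<Delta> \<and> \<not> derives \<Delta> \<theta>"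
proof -
  have "finite {\<Delta>. \<Delta> \<subseteq> S \<and> \<not> derives \<Delta> \<theta>}"
    by (rule finite_subset[of _ "Pow S"]) (auto simp: S)
  from finite_has_maximal2[OF this, of \<Gamma>] \<Gamma>
  obtain \<Delta> where \<Delta>: "\<Delta> \<subseteq> S" "\<not> derives \<Delta> \<theta>" "\<Gamma> \<subseteq> \<Delta>"
    and max: "\<And>E. E \<subseteq> S \<Longrightarrow> \<not> derives E \<theta> \<Longrightarrow> \<Delta> \<subseteq> E \<Longrightarrow> \<Delta> = E"
    by auto
  have ins: "derives (insert \<psi> \<Delta>) \<theta>" if "\<psi> \<in> S" "\<psi> \<notin> \<Delta>" for \<psi>
    using max[of "insert \<psi> \<Delta>"] \<Delta>(1) that by blast
  have "\<psi> \<in> \<Delta>" if "\<psi> \<in> S" "derives \<Delta> \<psi>" for \<psi>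
    using ins that \<Delta>(2) derives_cut by blast
  moreover have "\<psi> \<in> \<Delta> \<or> \<chi> \<in> \<Delta>" if D: "Disj \<psi> \<chi> \<in> \<Delta>" for \<psi> \<chi>
  proof (rule ccontr)
    assume "\<not> (\<psi> \<in> \<Delta> \<or> \<chi> \<in> \<Delta>)"
    then have "derives \<Delta> (Impl \<psi> \<theta>)" "derives \<Delta> (Impl \<chi> \<theta>)"
      using ins deduction S(2) D \<Delta>(1) by blast+
    then show False
      using derives.mp[OF derives.mp[OF derives.mp[OF derives.ax[OF disj_elim]]]] derives.hyp[OF D] \<Delta>(2)
      by blast
  qed
  ultimately show ?thesis
    using \<Delta> unfolding prime_theory_def by blast
qed

fun forces :: "'w set \<Rightarrow> ('w \<Rightarrow> 'w \<Rightarrow> bool) \<Rightarrow> (nat \<Rightarrow> 'w \<Rightarrow> bool) \<Rightarrow> sentence \<Rightarrow> 'w \<Rightarrow> bool" where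
  "forces W R V (Atom p) w = V p w"
| "forces W R V (Conj \<phi> \<psi>) w \<longleftrightarrow> forces W R V \<phi> w \<and> forces W R V \<psi> w"
| "forces W R V (Disj \<phi> \<psi>) w \<longleftrightarrow> forces W R V \<phi> w \<or> forces W R V \<psi> w"
| "forces W R V (Impl \<phi> \<psi>) w \<longleftrightarrow> (\<forall>u\<in>W. R w u \<longrightarrow> forces W R V \<phi> u \<longrightarrow> forces W R V \<psi> u)"
| "forces W R V (Neg \<phi>) w \<longleftrightarrow> (\<forall>u\<in>W. R w u \<longrightarrow> \<not> forces W R V \<phi> u)"

text \<open>The worlds name the prime theories through \<open>g\<close>. Implication and negation
  rest on extending a set that fails to derive a sentence to a prime theory with the same
  failure.\<close>

lemma truth_lemma:
  assumes g: "g ` W = {\<Gamma>. prime_theory (subsentences \<theta>) \<Gamma>}"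
    and "\<psi> \<in> subsentences \<theta>" "w \<in> W"
  shows "forces W (\<lambda>u w. g u \<subseteq> g w) (\<lambda>p w. Atom p \<in> g w) \<psi> w \<longleftrightarrow> \<psi> \<in> g w"
  using assms(2,3)
proof (induction \<psi> arbitrary: w)
  note closed = subsentences_closed(1-3)[of _ _ \<theta>] subsentences_closed(4)[of _ \<theta>]
  have prime: "g w \<subseteq> subsentences \<theta>" "\<And>\<psi>. \<psi> \<in> subsentences \<theta> \<Longrightarrow> derives (g w) \<psi> \<Longrightarrow> \<psi> \<in> g w"
    "\<And>\<psi> \<chi>. Disj \<psi> \<chi> \<in> g w \<Longrightarrow> \<psi> \<in> g w \<or> \<chi> \<in> g w" "\<exists>\<chi>. \<not> derives (g w) \<chi>" if "w \<in> W" for w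
  proof -
    have "g w \<in> {\<Gamma>. prime_theory (subsentences \<theta>) \<Gamma>}" using that unfolding g[symmetric] by (rule imageI)
    then show "g w \<subseteq> subsentences \<theta>" "\<And>\<psi>. \<psi> \<in> subsentences \<theta> \<Longrightarrow> derives (g w) \<psi> \<Longrightarrow> \<psi> \<in> g w"
      "\<And>\<psi> \<chi>. Disj \<psi> \<chi> \<in> g w \<Longrightarrow> \<psi> \<in> g w \<or> \<chi> \<in> g w" "\<exists>\<chi>. \<not> derives (g w) \<chi>"
      by (simp_all add: prime_theory_def)
  qed
  have ext: "\<exists>u\<in>W. \<Gamma> \<subseteq> g u \<and> \<not> derives (g u) \<chi>" if "\<Gamma> \<subseteq> subsentences \<theta>" "\<not> derives \<Gamma> \<chi>" for \<Gamma> \<chi>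
  proof -
    from prime_theory_extension[OF finite_subsentences closed(2) that]
    obtain \<Delta> where \<Delta>: "prime_theory (subsentences \<theta>) \<Delta>" "\<Gamma> \<subseteq> \<Delta>" "\<not> derives \<Delta> \<chi>" by blast
    then have "\<Delta> \<in> g ` W" unfolding g by simp
    with \<Delta> show ?thesis by blast
  qed
  {
    case (Atom p)
    show ?case by simp
  next
    case (Conj \<phi> \<psi>)
    have "Conj \<phi> \<psi> \<in> g w \<longleftrightarrow> \<phi> \<in> g w \<and> \<psi> \<in> g w"
    proof
      assume C: "Conj \<phi> \<psi> \<in> g w"
      have "derives (g w) \<phi>" "derives (g w) \<psi>"
        by (rule derives.mp[OF derives.ax[OF conj_elim1] derives.hyp[OF C]],
            rule derives.mp[OF derives.ax[OF conj_elim2] derives.hyp[OF C]])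
      then show "\<phi> \<in> g w \<and> \<psi> \<in> g w"
        using prime(2)[OF Conj.prems(2)] closed(1)[OF Conj.prems(1)] by simp
    next
      assume "\<phi> \<in> g w \<and> \<psi> \<in> g w"
      then have "derives (g w) (Conj \<phi> \<psi>)"
        by (intro derives.mp[OF derives.mp[OF derives.ax[OF conj_intro]]] derives.hyp) auto
      then show "Conj \<phi> \<psi> \<in> g w" using prime(2)[OF Conj.prems(2)] Conj.prems(1) by simp
    qed
    with closed(1)[OF Conj.prems(1)] show ?case using Conj.IH Conj.prems(2) by simp
  next
    case (Disj \<phi> \<psi>)
    have "Disj \<phi> \<psi> \<in> g w \<longleftrightarrow> \<phi> \<in> g w \<or> \<psi> \<in> g w"
    proof
      assume "\<phi> \<in> g w \<or> \<psi> \<in> g w"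
      then have "derives (g w) (Disj \<phi> \<psi>)"
      proof
        assume "\<phi> \<in> g w"
        from derives.hyp[OF this] show ?thesis by (rule derives.mp[OF derives.ax[OF disj_intro1]])
      next
        assume "\<psi> \<in> g w"
        from derives.hyp[OF this] show ?thesis by (rule derives.mp[OF derives.ax[OF disj_intro2]])
      qed
      then show "Disj \<phi> \<psi> \<in> g w" using prime(2)[OF Disj.prems(2)] Disj.prems(1) by simp
    qed (rule prime(3)[OF Disj.prems(2)])
    with closed(2)[OF Disj.prems(1)] show ?case using Disj.IH Disj.prems(2) by simp
  next
    case (Impl \<phi> \<psi>)
    have sub: "\<phi> \<in> subsentences \<theta>" "\<psi> \<in> subsentences \<theta>" using closed(3)[OF Impl.prems(1)] by auto
    have "(\<forall>u\<in>W. g w \<subseteq> g u \<longrightarrow> \<phi> \<in> g u \<longrightarrow> \<psi> \<in> g u) \<longleftrightarrow> Impl \<phi> \<psi> \<in> g w"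
    proof
      assume *: "\<forall>u\<in>W. g w \<subseteq> g u \<longrightarrow> \<phi> \<in> g u \<longrightarrow> \<psi> \<in> g u"
      show "Impl \<phi> \<psi> \<in> g w"
      proof (rule ccontr)
        assume "Impl \<phi> \<psi> \<notin> g w"
        then have "\<not> derives (insert \<phi> (g w)) \<psi>"
          using prime(2)[OF Impl.prems(2)] Impl.prems(1) deduction by blast
        with ext[of "insert \<phi> (g w)"] sub(1) prime(1)[OF Impl.prems(2)]
        obtain u where "u \<in> W" "insert \<phi> (g w) \<subseteq> g u" "\<not> derives (g u) \<psi>" by blast
        with * derives.hyp show False by blast
      qed
    next
      assume I: "Impl \<phi> \<psi> \<in> g w"
      show "\<forall>u\<in>W. g w \<subseteq> g u \<longrightarrow> \<phi> \<in> g u \<longrightarrow> \<psi> \<in> g u"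
      proof (intro ballI impI)
        fix u assume u: "u \<in> W" "g w \<subseteq> g u" "\<phi> \<in> g u"
        with I have "derives (g u) \<psi>"
          by (intro derives.mp[of _ \<phi> \<psi>] derives.hyp) auto
        with prime(2)[OF u(1)] sub show "\<psi> \<in> g u" by blast
      qed
    qed
    with sub show ?case using Impl.IH by simp
  next
    case (Neg \<phi>)
    have sub: "\<phi> \<in> subsentences \<theta>" by (rule closed(4)[OF Neg.prems(1)])
    have "(\<forall>u\<in>W. g w \<subseteq> g u \<longrightarrow> \<phi> \<notin> g u) \<longleftrightarrow> Neg \<phi> \<in> g w"
    proof
      assume *: "\<forall>u\<in>W. g w \<subseteq> g u \<longrightarrow> \<phi> \<notin> g u"
      show "Neg \<phi> \<in> g w"
      proof (rule ccontr)
        assume "Neg \<phi> \<notin> g w"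
        then have "\<not> derives (g w) (Neg \<phi>)"
          using prime(2)[OF Neg.prems(2)] Neg.prems(1) by blast
        \<comment> \<open>Otherwise \<open>\<phi>\<close> would imply both itself and its negation,
          and \<open>neg_intro\<close> would give \<open>Neg \<phi>\<close>. So
          \<open>insert \<phi> (g w)\<close> is consistent and has a prime extension.\<close>
        then have "\<not> derives (insert \<phi> (g w)) (Neg \<phi>)"
          using deduction[of \<phi> "g w" "Neg \<phi>"] derives_refl[of "g w" \<phi>]
            derives.mp[OF derives.mp[OF derives.ax[OF neg_intro[of \<phi> \<phi>]]]] by blast
        with ext[of "insert \<phi> (g w)"] sub(1) prime(1)[OF Neg.prems(2)]
        obtain u where "u \<in> W" "insert \<phi> (g w) \<subseteq> g u" by blast
        with * show False by blast
      qed
    next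
      assume N: "Neg \<phi> \<in> g w"
      show "\<forall>u\<in>W. g w \<subseteq> g u \<longrightarrow> \<phi> \<notin> g u"
      proof (intro ballI impI notI)
        fix u assume u: "u \<in> W" "g w \<subseteq> g u" "\<phi> \<in> g u"
        with N have "derives (g u) \<chi>" for \<chi>
          by (intro derives.mp[OF derives.mp[OF derives.ax[OF neg_elim[of \<phi> \<chi>]]]] derives.hyp) auto
        with prime(4)[OF u(1)] show False by blast
      qed
    qed
    with sub show ?case using Neg.IH by simp
  }
qed

definition finite_kripke_model :: "nat set \<Rightarrow> (nat \<Rightarrow> nat \<Rightarrow> bool) \<Rightarrow> (nat \<Rightarrow> nat \<Rightarrow> bool) \<Rightarrow> bool" where
  "finite_kripke_model W R V \<longleftrightarrow> finite W \<and> (\<forall>u\<in>W. R u u) \<and>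
     (\<forall>u\<in>W. \<forall>v\<in>W. \<forall>w\<in>W. R u v \<longrightarrow> R v w \<longrightarrow> R u w) \<and>
     (\<forall>u\<in>W. \<forall>v\<in>W. \<forall>p. R u v \<longrightarrow> V p u \<longrightarrow> V p v)"

theorem kripke_completeness:
  assumes "\<not> intuitionistic_provable \<phi>"
  shows "\<exists>W R V. finite_kripke_model W R V \<and> (\<exists>w\<in>W. \<not> forces W R V \<phi> w)"
proof -
  let ?P = "{\<Gamma>. prime_theory (subsentences \<phi>) \<Gamma>}"
  have "finite ?P"
    by (rule finite_subset[of _ "Pow (subsentences \<phi>)"])
      (auto simp: finite_subsentences prime_theory_def)
  then obtain f :: "sentence set \<Rightarrow> nat" and n where f: "f ` ?P = {i. i < n}" "inj_on f ?P"
    using finite_imp_inj_to_nat_seg by metis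
  define W where "W = {i. i < n}"
  define g where "g = inv_into ?P f"
  have g: "g ` W = ?P"
    unfolding g_def W_def f(1)[symmetric] using f(2) by auto
  let ?R = "\<lambda>u w. g u \<subseteq> g w" and ?V = "\<lambda>p w. Atom p \<in> g w"
  have "finite_kripke_model W ?R ?V"
    unfolding finite_kripke_model_def by (auto simp: W_def)
  moreover have "\<exists>w\<in>W. \<not> forces W ?R ?V \<phi> w"
  proof -
    have "\<not> derives {} \<phi>" using assms derives_empty by blast
    from prime_theory_extension[OF finite_subsentences[of \<phi>] subsentences_closed(2) empty_subsetI this]
    obtain \<Delta> where "\<Delta> \<in> ?P" "\<not> derives \<Delta> \<phi>" by blast
    with g obtain w where "w \<in> W" "\<not> derives (g w) \<phi>" by (metis imageE)
    with truth_lemma[OF g subsentences_self] derives.hyp show ?thesis by blast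
  qed
  ultimately show ?thesis by blast
qed

subsection \<open>A Turing antichain\<close>

definition turing_le :: "(nat \<Rightarrow> nat) \<Rightarrow> (nat \<Rightarrow> nat) \<Rightarrow> bool" where
  "turing_le f g \<longleftrightarrow> (\<exists>\<Phi>. partial_recursive_functional \<Phi> \<and> (\<forall>n. \<Phi> g n = Some (f n)))"

lemma turing_leI: "recursive_functional F \<Longrightarrow> turing_le (F g) g"
  unfolding turing_le_def recursive_functional_def by blast

lemma turing_le_trans:
  assumes "turing_le f g" "turing_le g h"
  shows "turing_le f h"
proof -
  have "strong_le {f} {g}" "strong_le {g} {h}"
    using assms unfolding turing_le_def strong_le_def by simp_all
  then have "strong_le {f} {h}" by (rule strong_le_trans)
  then show ?thesis unfolding turing_le_def strong_le_def by simp
qed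

lemma turing_le_fjoin:
  assumes "turing_le f h" "turing_le g h"
  shows "turing_le (fjoin f g) h"
proof -
  obtain \<Phi> \<Psi> where \<Phi>: "partial_recursive_functional \<Phi>" "\<forall>n. \<Phi> h n = Some (f n)"
    and \<Psi>: "partial_recursive_functional \<Psi>" "\<forall>n. \<Psi> h n = Some (g n)"
    using assms unfolding turing_le_def by blast
  from partial_recursive_functional.pair[OF \<Phi>(1) \<Psi>(1)] \<Phi>(2) \<Psi>(2) show ?thesis
    unfolding turing_le_def by (intro exI conjI) (assumption, simp add: fjoin_def)
qed

lemma turing_le_fjoin1: "turing_le f (fjoin f g)"
  using turing_leI[OF rf_fleft[OF rf_self], of "fjoin f g"] by simp

lemma turing_le_fjoin2: "turing_le g (fjoin f g)"
  using turing_leI[OF rf_fright[OF rf_self], of "fjoin f g"] by simp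

lemma turing_le_const: "turing_le (\<lambda>_. c) g"
  using turing_leI[OF rf_const] .

section \<open>Programs as indices of functionals, and functions generic for countably many
  requirements\<close>

datatype program =
    Query | Zero | Successor | Left | Right
  | Pairing program program | Composition program program | Recursion program program
  | Minimization program

instance program :: countable
  by countable_datatype

primrec run :: "program \<Rightarrow> (nat \<Rightarrow> nat) \<Rightarrow> nat \<rightharpoonup> nat" where
  "run Query = (\<lambda>g n. Some (g n))"
| "run Zero = (\<lambda>g n. Some 0)"
| "run Successor = (\<lambda>g n. Some (Suc n))"
| "run Left = (\<lambda>g n. Some (fst (prod_decode n)))"
| "run Right = (\<lambda>g n. Some (snd (prod_decode n)))"
| "run (Pairing p q) = (\<lambda>g n. Option.bind (run p g n)
     (\<lambda>a. Option.bind (run q g n) (\<lambda>b. Some (prod_encode (a, b)))))"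
| "run (Composition p q) = (\<lambda>g n. Option.bind (run p g n) (run q g))"
| "run (Recursion p q) = (\<lambda>g n. rec_nat (run p g (fst (prod_decode n)))
     (\<lambda>y r. Option.bind r (\<lambda>v. run q g (prod_encode (fst (prod_decode n), prod_encode (y, v)))))
     (snd (prod_decode n)))"
| "run (Minimization p) = (\<lambda>g n. minimize (\<lambda>m. run p g (prod_encode (n, m))))"

lemma run_surj: "partial_recursive_functional \<Phi> \<Longrightarrow> \<exists>p. \<Phi> = run p"
proof (induction rule: partial_recursive_functional.induct)
  case query show ?case by (metis run.simps(1))
next
  case zero show ?case by (metis run.simps(2))
next
  case succ show ?case by (metis run.simps(3))
next
  case left show ?case by (metis run.simps(4))
next
  case right show ?case by (metis run.simps(5))
next
  case (pair \<Phi> \<Psi>)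
  then obtain p q where "\<Phi> = run p" "\<Psi> = run q" by blast
  then show ?case by (intro exI[of _ "Pairing p q"]) simp
next
  case (comp \<Phi> \<Psi>)
  then obtain p q where "\<Phi> = run p" "\<Psi> = run q" by blast
  then show ?case by (intro exI[of _ "Composition p q"]) simp
next
  case (prec \<Phi> \<Psi>)
  then obtain p q where "\<Phi> = run p" "\<Psi> = run q" by blast
  then show ?case by (intro exI[of _ "Recursion p q"]) simp
next
  case (mu \<Phi>)
  then obtain p where "\<Phi> = run p" by blast
  then show ?case by (intro exI[of _ "Minimization p"]) simp
qed

text \<open>Continuity is read off from an approximation: the value is found on a segment of
  \<open>g\<close>, and soundness applies to every \<open>g'\<close> with this segment.\<close>

lemma use_principle:
  assumes "partial_recursive_functional \<Phi>" "\<Phi> g n = Some v"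
  shows "\<exists>m. \<forall>g'. (\<forall>i<m. g' i = g i) \<longrightarrow> \<Phi> g' n = Some v"
proof -
  obtain \<Theta> where \<Theta>: "approximates \<Theta> (\<lambda>h. \<Phi> (fright h))"
    using approximation[OF prf_subst[OF assms(1) rf_fright[OF rf_self]]] by blast
  have "\<Phi> (fright (fjoin g g)) n = Some v" using assms(2) by simp
  from eventually_happens'[OF sequentially_bot approximates_complete[OF \<Theta>, OF this]]
  obtain m where m: "\<Theta> g (prod_encode (initial_segment g m, n)) = Suc v" by blast
  have "\<Phi> g' n = Some v" if "\<forall>i<m. g' i = g i" for g'
  proof -
    have "segment_of (initial_segment g m) g'"
      using that by (simp add: segment_of_def segment_nth_initial)
    from approximates_sound[OF \<Theta>, OF this m] show ?thesis by simp
  qed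
  then show ?thesis by blast
qed

text \<open>The finite extension method. A pair of \<open>y\<close> and \<open>m\<close> stands for
  the finite condition given by \<open>y\<close> below \<open>m\<close>; by hypothesis every
  condition has an extension that forces \<open>Q k\<close>.\<close>

lemma generic_function:
  fixes Q :: "nat \<Rightarrow> (nat \<Rightarrow> nat) \<Rightarrow> bool"
  assumes dense: "\<And>k y m. \<exists>y' m'. (\<forall>i<m. y' i = y i) \<and> (\<forall>z. (\<forall>i<m'. z i = y' i) \<longrightarrow> Q k z)"
  shows "\<exists>z. \<forall>k. Q k z"
proof -
  let ?step = "\<lambda>k (y::nat \<Rightarrow> nat, m) (y', m'). m < m' \<and> (\<forall>i<m. y' i = y i) \<and>
      (\<forall>z. (\<forall>i<m'. z i = y' i) \<longrightarrow> Q k z)"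
  have step: "\<exists>c'. ?step k c c'" for k c
  proof -
    obtain y m where c: "c = (y, m)" by force
    obtain y' m' where "\<forall>i<m. y' i = y i" "\<forall>z. (\<forall>i<m'. z i = y' i) \<longrightarrow> Q k z"
      using dense by blast
    \<comment> \<open>The length is pushed beyond \<open>m\<close> so that the limit is defined
      everywhere.\<close>
    then show ?thesis unfolding c by (intro exI[of _ "(y', max m' (Suc m))"]) auto
  qed
  obtain f where f: "\<And>k. ?step k (f k) (f (Suc k))"
    using dependent_nat_choice[of "\<lambda>_ _. True" ?step] step by auto
  define y m where "y = (\<lambda>k. fst (f k))" and "m = (\<lambda>k. snd (f k))"
  have less: "m k < m (Suc k)" and ext: "\<And>i. i < m k \<Longrightarrow> y (Suc k) i = y k i"
    and Q: "\<And>z. (\<And>i. i < m (Suc k) \<Longrightarrow> z i = y (Suc k) i) \<Longrightarrow> Q k z" for k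
    using f[of k] by (auto simp: y_def m_def split: prod.splits)
  have ge: "k \<le> m k" for k
    by (induction k) (use less in \<open>auto simp: Suc_le_eq intro: le_less_trans\<close>)
  have agree: "y l i = y k i" if "k \<le> l" "i < m k" for k l i
    using that
  proof (induction l rule: dec_induct)
    case (step l)
    have "m k \<le> m l" using lift_Suc_mono_le[of m, OF less_imp_le[OF less] step(1)] .
    with step ext[of i l] show ?case by simp
  qed simp
  \<comment> \<open>Stage \<open>Suc i\<close> has length greater than \<open>i\<close>, so its
    value at \<open>i\<close> is final.\<close>
  define z where "z = (\<lambda>i. y (Suc i) i)"
  have "Q k z" for k
  proof (rule Q)
    fix i assume i: "i < m (Suc k)"
    have "i < m (Suc i)" using ge[of "Suc i"] by simp
    with i agree[of "Suc i" "Suc k" i] agree[of "Suc k" "Suc i" i] show "z i = y (Suc k) i"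
      unfolding z_def by (metis nat_le_linear)
  qed
  then show ?thesis by blast
qed

text \<open>The functions are the columns of one generic function. The requirement for
  \<open>p\<close>, \<open>u\<close> and \<open>v\<close> is that \<open>p\<close> does not compute
  column \<open>v\<close> from column \<open>u\<close>.\<close>

lemma turing_antichain_exists: "\<exists>x :: nat \<Rightarrow> nat \<Rightarrow> nat. \<forall>u v. u \<noteq> v \<longrightarrow> \<not> turing_le (x v) (x u)"
proof -
  define Q where "Q = (\<lambda>(p, u, v) (z::nat \<Rightarrow> nat). u \<noteq> v \<longrightarrow>
     \<not> (\<forall>n. run p (\<lambda>j. z (prod_encode (u, j))) n = Some (z (prod_encode (v, n)))))"
  have "\<exists>z. \<forall>k. Q (from_nat k :: program \<times> nat \<times> nat) z"
  proof (rule generic_function)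
    fix k m :: nat and y :: "nat \<Rightarrow> nat"
    obtain p u v where k: "(from_nat k :: program \<times> nat \<times> nat) = (p, u, v)" by (metis prod_cases3)
    \<comment> \<open>Entry \<open>m\<close> of column \<open>v\<close> sits at a position not below
      \<open>m\<close>, so the given condition leaves it free.\<close>
    define c where "c = prod_encode (v, m)"
    have "m \<le> c" unfolding c_def by (rule le_prod_encode_2)
    let ?goal = "\<exists>y' m'. (\<forall>i<m. y' i = y i) \<and> (\<forall>z. (\<forall>i<m'. z i = y' i) \<longrightarrow> Q (from_nat k) z)"
    show ?goal
    proof (cases "u \<noteq> v \<and> (\<exists>z a. (\<forall>i<m. z i = y i) \<and> run p (\<lambda>j. z (prod_encode (u, j))) m = Some a)")
      \<comment> \<open>Either \<open>u = v\<close> and nothing is required, or no extension makes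
        \<open>p\<close> converge at \<open>m\<close> and the given condition already forces the
        requirement.\<close>
      case False
      have "Q (from_nat k) z" if "\<forall>i<m. z i = y i" for z
        unfolding k Q_def prod.case
      proof (intro impI notI)
        assume "u \<noteq> v"
          "\<forall>n. run p (\<lambda>j. z (prod_encode (u, j))) n = Some (z (prod_encode (v, n)))"
        with False that show False by blast
      qed
      then show ?thesis by blast
    next
      case True
      then obtain z a where uv: "u \<noteq> v" and z: "\<forall>i<m. z i = y i"
        and a: "run p (\<lambda>j. z (prod_encode (u, j))) m = Some a" by blast
      have "partial_recursive_functional (run p)"
        by (induction p) (auto intro: partial_recursive_functional.intros)
      from use_principle[OF this, OF a] obtain l
        where l: "\<And>g. \<forall>i<l. g i = z (prod_encode (u, i)) \<Longrightarrow> run p g m = Some a" by blast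
      have "finite (insert c ((\<lambda>i. prod_encode (u, i)) ` {..<l}))" by simp
      then obtain m' where m': "\<forall>i\<in>insert c ((\<lambda>i. prod_encode (u, i)) ` {..<l}). i < m'"
        unfolding finite_nat_set_iff_bounded by blast
      \<comment> \<open>The value \<open>Suc a\<close> contradicts the computed \<open>a\<close>. As
        \<open>u\<close> and \<open>v\<close> differ, position \<open>c\<close> lies outside column
        \<open>u\<close>, and the computation is not disturbed.\<close>
      have "Q (from_nat k) z'" if z': "\<forall>i<m'. z' i = (z(c := Suc a)) i" for z'
      proof -
        have "run p (\<lambda>j. z' (prod_encode (u, j))) m = Some a"
          by (rule l) (use z' m' uv in \<open>auto simp: c_def\<close>)
        moreover have "z' c = Suc a" using z' m' by simp
        ultimately show ?thesis unfolding k Q_def by (auto simp: c_def intro!: exI[of _ m])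
      qed
      moreover have "\<forall>i<m. (z(c := Suc a)) i = y i" using z \<open>m \<le> c\<close> by auto
      ultimately show ?thesis by blast
    qed
  qed
  then obtain z where z: "\<And>k. Q (from_nat k :: program \<times> nat \<times> nat) z" by blast
  have "\<not> turing_le (\<lambda>j. z (prod_encode (v, j))) (\<lambda>j. z (prod_encode (u, j)))" if uv: "u \<noteq> v" for u v
  proof
    assume "turing_le (\<lambda>j. z (prod_encode (v, j))) (\<lambda>j. z (prod_encode (u, j)))"
    then obtain p where "\<forall>n. run p (\<lambda>j. z (prod_encode (u, j))) n = Some (z (prod_encode (v, n)))"
      unfolding turing_le_def using run_surj by metis
    then show False using z[of "to_nat (p, u, v)"] uv unfolding from_nat_to_nat Q_def by simp
  qed
  then show ?thesis by (intro exI[of _ "\<lambda>u j. z (prod_encode (u, j))"]) blast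
qed

section \<open>Mass problems avoiding lower cones of the antichain, and their residuals\<close>

definition antichain :: "nat \<Rightarrow> nat \<Rightarrow> nat" where
  "antichain = (SOME x. \<forall>u v. u \<noteq> v \<longrightarrow> \<not> turing_le (x v) (x u))"

lemma antichain: "u \<noteq> v \<Longrightarrow> \<not> turing_le (antichain v) (antichain u)"
  using someI_ex[OF turing_antichain_exists] unfolding antichain_def[symmetric] by simp

definition nonbelow :: "nat set \<Rightarrow> (nat \<Rightarrow> nat) set" where
  "nonbelow F = {f. \<forall>u\<in>F. \<not> turing_le f (antichain u)}"

lemma nonbelow_upward: "f \<in> nonbelow F \<Longrightarrow> turing_le f g \<Longrightarrow> g \<in> nonbelow F"
  unfolding nonbelow_def using turing_le_trans by blast

lemma nonbelow_antimono: "F \<subseteq> G \<Longrightarrow> nonbelow G \<subseteq> nonbelow F"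
  unfolding nonbelow_def by blast

lemma antichain_nonbelow: "u \<notin> F \<Longrightarrow> antichain u \<in> nonbelow F"
  unfolding nonbelow_def mem_Collect_eq by (metis antichain)

text \<open>Prefixing a segment leaves the Turing degree unchanged, so a member of
  \<open>nonbelow F\<close> can be made to start with any \<open>s\<close> without leaving the
  set.\<close>

definition graft :: "nat \<Rightarrow> (nat \<Rightarrow> nat) \<Rightarrow> nat \<Rightarrow> nat" where
  "graft s a n = (if n < segment_length s then segment_nth s n else a (n - segment_length s))"

lemma segment_of_graft: "segment_of s (graft s a)"
  by (simp add: segment_of_def graft_def)

lemma graft_turing_le: "turing_le (graft s a) a"
proof -
  have "recursive_functional (graft s)" unfolding graft_def by (intro rf_intros)
  then show ?thesis by (rule turing_leI)
qed

lemma turing_le_graft: "turing_le a (graft s a)"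
proof -
  have "recursive_functional (\<lambda>g n. g (n + segment_length s))" by (intro rf_intros)
  from turing_leI[OF this, of "graft s a"] show ?thesis by (simp add: graft_def)
qed

text \<open>A reduction to a sum commits itself to a summand on a finite part of its input, and this
  part can be found without knowing the member of \<^term>\<open>nonbelow G\<close>; the remaining input is then
  free to be any \<^term>\<open>antichain u\<close> with \<open>u \<notin> G\<close>.\<close>

lemma nonbelow_residual:
  assumes "finite G"
    and red: "strong_le (mass_sum I (\<lambda>i. nonbelow (S i))) (mass_join (nonbelow G) C)"
  shows "strong_le (mass_sum I (\<lambda>i. nonbelow (S i - G))) C"
proof -
  obtain \<Phi> where \<Phi>: "partial_recursive_functional \<Phi>"
    "\<And>g. g \<in> mass_join (nonbelow G) C \<Longrightarrow> \<exists>f\<in>mass_sum I (\<lambda>i. nonbelow (S i)). \<forall>n. \<Phi> g n = Some (f n)"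
    using red unfolding strong_le_def by blast
  have swap: "recursive_functional (\<lambda>h. fjoin (fright h) (fleft h))" by (intro rf_fun)
  obtain \<Theta> where \<Theta>: "recursive_functional \<Theta>" "approximates \<Theta> (\<lambda>h. \<Phi> (fjoin (fright h) (fleft h)))"
    using approximation[OF prf_subst[OF \<Phi>(1) swap]] by blast
  \<comment> \<open>The output at argument \<open>0\<close> contains the tag of the summand, so
    approximating this single value is enough to learn the tag.\<close>
  let ?\<theta> = "\<lambda>c m. \<Theta> c (prod_encode (snd (prod_decode m), 0))"
  have \<theta>: "recursive_functional ?\<theta>" by (rule rf_comp[OF \<Theta>(1)]) (intro rf_intros)
  let ?T = "\<lambda>c m. if ?\<theta> c m = 0 then 1 else (0::nat)"
  \<comment> \<open>The new reduction returns \<open>c\<close> itself and only adds the tag.\<close>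
  let ?V = "\<lambda>c m. prod_encode (fst (prod_decode (?\<theta> c m - 1)), c (fst (prod_decode m)))"
  have T: "recursive_functional ?T" and V: "recursive_functional ?V" by (intro rf_intros \<theta>)+
  obtain \<Psi> where \<Psi>: "partial_recursive_functional \<Psi>"
    and \<Psi>_eq': "\<And>g n. \<exists>s. ?T g (prod_encode (n, s)) = 0 \<Longrightarrow>
      \<Psi> g n = Some (?V g (prod_encode (n, LEAST s. ?T g (prod_encode (n, s)) = 0)))"
    using prf_search[OF T V] by blast
  have T0: "?T c (prod_encode (n, s)) = 0 \<longleftrightarrow> \<Theta> c (prod_encode (s, 0)) \<noteq> 0" for c n s
    by simp
  \<comment> \<open>As \<open>G\<close> is finite, some \<open>antichain w\<close> lies in
    \<open>nonbelow G\<close>; the given reduction converges on it, so the search for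
    \<open>s\<close> ends.\<close>
  obtain w where w: "w \<notin> G" using ex_new_if_finite[OF infinite_UNIV_nat \<open>finite G\<close>] by blast
  have "\<exists>f\<in>mass_sum I (\<lambda>i. nonbelow (S i - G)). \<forall>n. \<Psi> c n = Some (f n)" if "c \<in> C" for c
  proof -
    have red: "\<exists>i\<in>I. \<exists>f\<in>nonbelow (S i). \<forall>n. \<Phi> (fjoin a c) n = Some (fjoin (\<lambda>_. i) f n)"
      if "a \<in> nonbelow G" for a
      using \<Phi>(2)[of "fjoin a c"] \<open>c \<in> C\<close> that by (auto simp: mass_join_def mass_sum_def)
    obtain q where q: "\<Phi> (fjoin (fright (fjoin c (antichain w))) (fleft (fjoin c (antichain w)))) 0 = Some q"
      using red[OF antichain_nonbelow[OF w]] by auto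
    have ex: "\<exists>s. \<Theta> c (prod_encode (s, 0)) \<noteq> 0"
      using eventually_happens'[OF sequentially_bot approximates_complete[OF \<Theta>(2), OF q]]
      by (metis nat.distinct(1))
    \<comment> \<open>This \<open>s\<close> can be any code and need not be a segment of
      \<open>antichain w\<close>; grafting makes every member of \<open>nonbelow G\<close> start
      with it.\<close>
    define s where "s = (LEAST s. \<Theta> c (prod_encode (s, 0)) \<noteq> 0)"
    have "\<Theta> c (prod_encode (s, 0)) \<noteq> 0" unfolding s_def by (rule LeastI_ex[OF ex])
    then obtain v where v: "\<Theta> c (prod_encode (s, 0)) = Suc v" by (metis not0_implies_Suc)
    define i where "i = fst (prod_decode v)"
    have \<Psi>_eq: "\<Psi> c n = Some (fjoin (\<lambda>_. i) c n)" for n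
      using \<Psi>_eq'[of c n, unfolded T0, OF ex, folded s_def] v by (simp add: i_def fjoin_def)
    have graft: "i \<in> I \<and> (\<exists>f\<in>nonbelow (S i). turing_le f (fjoin (graft s a) c))"
      if a: "a \<in> nonbelow G" for a
    proof -
      obtain j f where j: "j \<in> I" "f \<in> nonbelow (S j)"
        and eq: "\<And>n. \<Phi> (fjoin (graft s a) c) n = Some (fjoin (\<lambda>_. j) f n)"
        using red[OF nonbelow_upward[OF a turing_le_graft]] by blast
      have "fjoin (\<lambda>_. j) f 0 = v"
        using approximates_sound[OF \<Theta>(2), OF segment_of_graft v] eq[of 0] by simp
      then have "j = i" by (auto simp: i_def fjoin_def)
      moreover have "turing_le (fjoin (\<lambda>_. j) f) (fjoin (graft s a) c)"
        unfolding turing_le_def using \<Phi>(1) eq by blast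
      ultimately show ?thesis using j turing_le_trans[OF turing_le_fjoin2] by blast
    qed
    have "c \<in> nonbelow (S i - G)"
      unfolding nonbelow_def
    \<comment> \<open>If \<open>c\<close> were computable from \<open>antichain u\<close>, then so
      would be its join with the grafted \<open>antichain u\<close>, and hence the output
      \<open>f\<close>; but \<open>u \<in> S i\<close> forbids this.\<close>
    proof (clarify)
      fix u assume u: "u \<in> S i" "u \<notin> G" and c: "turing_le c (antichain u)"
      obtain f where f: "f \<in> nonbelow (S i)" "turing_le f (fjoin (graft s (antichain u)) c)"
        using graft[OF antichain_nonbelow[OF u(2)]] by blast
      have "turing_le f (antichain u)"
        by (rule turing_le_trans[OF f(2) turing_le_fjoin[OF graft_turing_le c]])
      with f(1) u(1) show False unfolding nonbelow_def by blast
    qed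
    moreover have "i \<in> I" using graft[OF antichain_nonbelow[OF w]] by blast
    ultimately show ?thesis
      using \<Psi>_eq by (intro bexI[of _ "fjoin (\<lambda>_. i) c"]) (auto simp: mass_sum_def)
  qed
  with \<Psi> show ?thesis unfolding strong_le_def by blast
qed

subsection \<open>Degrees attached to finite sets of vertices\<close>

definition deg :: "(nat \<Rightarrow> nat) set \<Rightarrow> strong_degree" where
  "deg = abs_strong_degree"

lemma deg_le_iff [simp]: "deg P \<le> deg Q \<longleftrightarrow> strong_le P Q"
  unfolding deg_def by (rule less_eq_strong_degree.abs_eq)

lemma deg_sup: "sup (deg P) (deg Q) = deg (mass_join P Q)"
  unfolding deg_def by (rule sup_strong_degree.abs_eq)

lemma deg_inf: "inf (deg P) (deg Q) = deg (mass_meet P Q)"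
  unfolding deg_def by (rule inf_strong_degree.abs_eq)

lemma deg_UNIV: "deg UNIV = bot"
  unfolding deg_def by (rule bot_strong_degree.abs_eq[symmetric])

lemma deg_surj: "\<exists>P. c = deg P"
  unfolding deg_def by (metis Quotient_strong_degree Quotient_abs_rep)

definition cone :: "nat set \<Rightarrow> strong_degree" where
  "cone F = deg (nonbelow F)"

lemma cone_mono: "F \<subseteq> G \<Longrightarrow> cone F \<le> cone G"
  by (simp add: cone_def nonbelow_antimono strong_le_superset)

lemma cone_empty: "cone {} = bot"
  by (simp add: cone_def nonbelow_def deg_UNIV)

lemma fjoin_nonbelow: "f \<in> nonbelow F \<Longrightarrow> g \<in> nonbelow G \<Longrightarrow> fjoin f g \<in> nonbelow (F \<union> G)"
  using nonbelow_upward[OF _ turing_le_fjoin1[of f g], of F] nonbelow_upward[OF _ turing_le_fjoin2[of g f], of G]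
  by (auto simp: nonbelow_def)

lemma cone_Un: "cone (F \<union> G) = sup (cone F) (cone G)"
proof (rule antisym)
  show "cone (F \<union> G) \<le> sup (cone F) (cone G)"
    by (auto simp: cone_def deg_sup mass_join_def intro!: strong_le_superset fjoin_nonbelow)
qed (simp add: cone_mono)

text \<open>A new summand can be split off by comparing the tag with \<open>j\<close>, so adding
  finitely many summands to a sum acts like a meet even though the whole sum does not.\<close>

lemma deg_mass_sum_finite:
  assumes "finite J" "c \<le> deg (mass_sum I P)" "\<And>j. j \<in> J \<Longrightarrow> c \<le> deg (P j)"
  shows "c \<le> deg (mass_sum (I \<union> J) P)"
  using assms(1,3)
proof (induction J)
  case empty
  then show ?case using assms(2) by simp
next
  case (insert j J)
  have F: "recursive_functional (\<lambda>h n. if fleft h 0 = j then fjoin (\<lambda>_. 0) (fright h) n else fjoin (\<lambda>_. 1) h n)"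
    unfolding fleft_def fright_def fjoin_def by (intro rf_intros)
  have "strong_le (mass_meet (P j) (mass_sum (I \<union> J) P)) (mass_sum (I \<union> insert j J) P)"
  proof (rule strong_leI[OF F])
    fix h assume "h \<in> mass_sum (I \<union> insert j J) P"
    then obtain i f where i: "i \<in> I \<union> insert j J" and f: "f \<in> P i" and h: "h = fjoin (\<lambda>_. i) f"
      unfolding mass_sum_def by blast
    show "(\<lambda>n. if fleft h 0 = j then fjoin (\<lambda>_. 0) (fright h) n else fjoin (\<lambda>_. 1) h n) \<in>
        mass_meet (P j) (mass_sum (I \<union> J) P)"
    proof (cases "i = j")
      case True
      then show ?thesis using f by (simp add: h mass_meet_iff)
    next
      case False
      then show ?thesis using i f by (auto simp: h mass_meet_iff mass_sum_def)
    qed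
  qed
  then have "inf (deg (P j)) (deg (mass_sum (I \<union> J) P)) \<le> deg (mass_sum (I \<union> insert j J) P)"
    by (simp add: deg_inf)
  with insert show ?case by (meson insertCI le_infI order_trans)
qed

text \<open>Distributivity over two finite meets at once reduces a lower bound to joins of single
  members.\<close>

lemma le_sup_Inf_fin:
  fixes d :: "'a::distrib_lattice"
  assumes "finite A" "A \<noteq> {}" "finite B" "B \<noteq> {}" "\<And>x y. x \<in> A \<Longrightarrow> y \<in> B \<Longrightarrow> d \<le> sup x y"
  shows "d \<le> sup (Inf_fin A) (Inf_fin B)"
proof -
  have *: "{sup a b |a b. a \<in> A \<and> b \<in> B} = (\<lambda>(a, b). sup a b) ` (A \<times> B)" by auto
  show ?thesis
    unfolding sup_Inf2_distrib[OF assms(1-4)] unfolding *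
    using assms by (intro Inf_fin.boundedI) auto
qed

subsection \<open>The initial segment\<close>

text \<open>The worlds of all the models are the vertices of one graph, the \<open>p\<close>-th world of the \<open>k\<close>-th
  model being the vertex \<^term>\<open>prod_encode (k, p)\<close>, with edges between comparable worlds of the same
  model. Its cliques are the chains of the models.\<close>

locale models =
  fixes W :: "nat \<Rightarrow> nat set" and R V :: "nat \<Rightarrow> nat \<Rightarrow> nat \<Rightarrow> bool"
  assumes model: "finite_kripke_model (W k) (R k) (V k)"
begin

lemma finite_W: "finite (W k)"
  and refl: "p \<in> W k \<Longrightarrow> R k p p"
  and trans: "p \<in> W k \<Longrightarrow> q \<in> W k \<Longrightarrow> s \<in> W k \<Longrightarrow> R k p q \<Longrightarrow> R k q s \<Longrightarrow> R k p s"
  and persistent: "p \<in> W k \<Longrightarrow> q \<in> W k \<Longrightarrow> R k p q \<Longrightarrow> V k a p \<Longrightarrow> V k a q"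
  using model[of k] unfolding finite_kripke_model_def by blast+

definition nonedges :: "nat set" where
  "nonedges = {prod_encode (prod_encode (k, p), prod_encode (l, q)) | k p l q.
     p \<in> W k \<and> q \<in> W l \<and> \<not> (k = l \<and> (R k p q \<or> R k q p))}"

definition ends :: "nat \<Rightarrow> nat set" where
  "ends i = {fst (prod_decode i), snd (prod_decode i)}"

definition bound :: strong_degree where
  "bound = deg (mass_sum nonedges (\<lambda>i. nonbelow (ends i)))"

definition vertices :: "nat \<Rightarrow> nat set \<Rightarrow> nat set" where
  "vertices k F = (\<lambda>p. prod_encode (k, p)) ` F"

lemma vertices_Un: "vertices k (F \<union> G) = vertices k F \<union> vertices k G"
  by (auto simp: vertices_def)

lemma vertices_Diff: "vertices k (F - G) = vertices k F - vertices k G"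
  by (auto simp: vertices_def)

definition face :: "nat \<Rightarrow> nat set \<Rightarrow> strong_degree" where
  "face k F = cone (vertices k F)"

lemma face_mono: "F \<subseteq> G \<Longrightarrow> face k F \<le> face k G"
  unfolding face_def vertices_def by (intro cone_mono image_mono)

lemma face_Un: "face k (F \<union> G) = sup (face k F) (face k G)"
  by (simp add: face_def vertices_Un cone_Un)

lemma face_empty: "face k {} = bot"
  by (simp add: face_def vertices_def cone_empty)

definition other_vertices :: "nat \<Rightarrow> nat set" where
  "other_vertices k = {prod_encode (l, q) | l q. l \<noteq> k \<and> q \<in> W l}"

definition outside :: "nat \<Rightarrow> strong_degree" where
  "outside k = deg (mass_sum (other_vertices k) (\<lambda>u. nonbelow {u}))"

definition chain :: "nat \<Rightarrow> nat set \<Rightarrow> bool" where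
  "chain k F \<longleftrightarrow> (\<forall>p\<in>F. \<forall>q\<in>F. R k p q \<or> R k q p)"

lemma bound_le_face:
  assumes "F \<subseteq> W k" "\<not> chain k F"
  shows "bound \<le> face k F"
proof -
  obtain p q where pq: "p \<in> F" "q \<in> F" "\<not> (R k p q \<or> R k q p)"
    using assms(2) unfolding chain_def by blast
  define i where "i = prod_encode (prod_encode (k, p), prod_encode (k, q))"
  have "i \<in> nonedges" using pq assms(1) unfolding i_def nonedges_def by blast
  then have "bound \<le> cone (ends i)"
    using mass_sum_le unfolding bound_def cone_def by simp
  also have "\<dots> \<le> face k F"
    unfolding face_def using pq by (intro cone_mono) (auto simp: ends_def i_def vertices_def)
  finally show ?thesis .
qed

text \<open>A world of the \<open>k\<close>-th model and a vertex of another model always form a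
  nonedge. The other vertex is the tag of the second component, so one reduction handles all
  summands of \<open>outside k\<close>.\<close>

lemma bound_le_sup_outside:
  assumes "p \<in> W k"
  shows "bound \<le> sup (face k {p}) (outside k)"
proof -
  define c where "c = prod_encode (k, p)"
  let ?F = "\<lambda>h. fjoin (\<lambda>n. prod_encode (fleft (fright h) n, c)) (fjoin (fright (fright h)) (fleft h))"
  have rf: "recursive_functional ?F"
    unfolding fleft_def fright_def fjoin_def by (intro rf_intros)
  have "strong_le (mass_sum nonedges (\<lambda>i. nonbelow (ends i)))
      (mass_join (nonbelow {c}) (mass_sum (other_vertices k) (\<lambda>u. nonbelow {u})))"
  proof (rule strong_leI[OF rf])
    fix h assume "h \<in> mass_join (nonbelow {c}) (mass_sum (other_vertices k) (\<lambda>u. nonbelow {u}))"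
    then obtain f u g where h: "h = fjoin f (fjoin (\<lambda>_. u) g)" and f: "f \<in> nonbelow {c}"
      and u: "u \<in> other_vertices k" and g: "g \<in> nonbelow {u}"
      unfolding mass_join_def mass_sum_def by blast
    have "prod_encode (u, c) \<in> nonedges"
      using u assms unfolding other_vertices_def nonedges_def c_def by blast
    moreover have "fjoin g f \<in> nonbelow (ends (prod_encode (u, c)))"
      using fjoin_nonbelow[OF g f] by (simp add: ends_def insert_commute)
    ultimately show "?F h \<in> mass_sum nonedges (\<lambda>i. nonbelow (ends i))"
      unfolding mass_sum_def h by auto
  qed
  then show ?thesis
    by (simp add: bound_def face_def outside_def cone_def vertices_def c_def deg_sup)
qed

text \<open>Including \<open>bound\<close> keeps the meet inside the initial segment and makes the
  meet of no faces its top.\<close>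

definition meets :: "nat \<Rightarrow> nat set set \<Rightarrow> strong_degree" where
  "meets k U = Inf_fin (insert bound (face k ` U))"

text \<open>Relative to \<^term>\<open>face k G\<close>, the summands of \<^term>\<open>bound\<close> at nonedges not inside the \<open>k\<close>-th
  model still contain a vertex of another model, so that they all lie above \<^term>\<open>outside k\<close>.\<close>

definition residuals :: "nat \<Rightarrow> nat set set \<Rightarrow> strong_degree" where
  "residuals k U = Inf_fin (insert (outside k) (face k ` U))"

lemma finite_faces: "U \<subseteq> Pow (W k) \<Longrightarrow> finite U"
  using finite_W by (meson finite_Pow_iff finite_subset)

text \<open>The first component tells the nonedges from the members of \<open>U\<close>.\<close>

definition summand :: "nat \<Rightarrow> nat \<Rightarrow> nat set" where
  "summand k i = (if fst (prod_decode i) = 0 then ends (snd (prod_decode i))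
     else vertices k (set_decode (snd (prod_decode i))))"

definition summands :: "nat set set \<Rightarrow> nat set" where
  "summands U = (\<lambda>i. prod_encode (0, i)) ` nonedges \<union> (\<lambda>F. prod_encode (1, set_encode F)) ` U"

text \<open>A single sum over the nonedges and the members of \<open>U\<close> lies below the finite
  meet, so the residual of a sum can be taken for all of them at once.\<close>

lemma meets_residual:
  assumes U: "U \<subseteq> Pow (W k)" and G: "G \<subseteq> W k"
    and le: "meets k U \<le> sup (face k G) (deg C)"
  shows "strong_le (mass_sum (summands U) (\<lambda>i. nonbelow (summand k i - vertices k G))) C"
proof (rule nonbelow_residual)
  show "finite (vertices k G)"
    unfolding vertices_def using G finite_W finite_subset by blast
  let ?X = "mass_sum (summands U) (\<lambda>i. nonbelow (summand k i))"
  have "deg ?X \<le> bound"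
  proof -
    have F: "recursive_functional (\<lambda>h. fjoin (\<lambda>n. prod_encode (0, fleft h n)) (fright h))"
      unfolding fleft_def fright_def fjoin_def by (intro rf_intros)
    show ?thesis
      unfolding bound_def deg_le_iff
      by (rule strong_leI[OF F]) (auto simp: mass_sum_def summands_def summand_def)
  qed
  moreover have "deg ?X \<le> face k F" if "F \<in> U" for F
  proof -
    have "finite F" using that U finite_W finite_subset by blast
    then have "summand k (prod_encode (1, set_encode F)) = vertices k F"
      by (simp add: summand_def)
    with mass_sum_le[of "prod_encode (1, set_encode F)" "summands U" "\<lambda>i. nonbelow (summand k i)"] that
    show ?thesis by (simp add: face_def cone_def summands_def)
  qed
  ultimately have "deg ?X \<le> meets k U"
    unfolding meets_def using finite_faces[OF U] by (intro Inf_fin.boundedI) auto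
  with le have "deg ?X \<le> deg (mass_join (nonbelow (vertices k G)) C)"
    by (simp add: face_def cone_def deg_sup[symmetric] del: deg_le_iff)
  then show "strong_le ?X (mass_join (nonbelow (vertices k G)) C)" by simp
qed

text \<open>The summands \<open>I\<close>, at nonedges that leave the model, may be infinitely many;
  one uniform reduction bounds their sum below by \<open>outside k\<close>. The remaining
  \<open>J\<close> is finite and is treated summand by summand: the two ends of a nonedge inside the
  model are not a chain, hence form a member of \<open>U\<close>.\<close>

lemma residuals_le:
  assumes U: "U \<subseteq> Pow (W k)" and nonchains: "\<And>F. F \<subseteq> W k \<Longrightarrow> \<not> chain k F \<Longrightarrow> F \<in> U"
    and G: "G \<subseteq> W k"
    and le: "meets k U \<le> sup (face k G) c"
  shows "residuals k ((\<lambda>F. F - G) ` U) \<le> c"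
proof -
  obtain C where C: "c = deg C" using deg_surj by blast
  let ?P = "\<lambda>i. nonbelow (summand k i - vertices k G)"
  let ?inner = "{prod_encode (prod_encode (k, p), prod_encode (k, q)) | p q.
      p \<in> W k \<and> q \<in> W k \<and> \<not> (R k p q \<or> R k q p)}"
  define I where "I = (\<lambda>i. prod_encode (0, i)) ` (nonedges - ?inner)"
  define J where "J = (\<lambda>i. prod_encode (0, i)) ` ?inner \<union> (\<lambda>F. prod_encode (1, set_encode F)) ` U"
  have fin: "finite (insert (outside k) (face k ` (\<lambda>F. F - G) ` U))" using finite_faces[OF U] by simp
  have "?inner \<subseteq> nonedges" unfolding nonedges_def by blast
  then have sub: "summands U = I \<union> J"
    unfolding summands_def I_def J_def Un_assoc[symmetric] image_Un[symmetric] Un_Diff_cancel2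
    by (simp add: Un_absorb2)
  have "?inner \<subseteq> (\<lambda>(p, q). prod_encode (prod_encode (k, p), prod_encode (k, q))) ` (W k \<times> W k)" by auto
  then have "finite ?inner" by (rule finite_subset) (simp add: finite_W)
  then have "finite J" unfolding J_def using finite_faces[OF U] by simp
  have face_le: "residuals k ((\<lambda>F. F - G) ` U) \<le> face k (F - G)" if "F \<in> U" for F
    unfolding residuals_def by (rule Inf_fin.coboundedI[OF fin]) (use that in auto)
  have J: "residuals k ((\<lambda>F. F - G) ` U) \<le> deg (?P j)" if j: "j \<in> J" for j
  proof -
    consider F where "F \<in> U" "j = prod_encode (1, set_encode F)"
      | p q where "j = prod_encode (0, prod_encode (prod_encode (k, p), prod_encode (k, q)))"
        "p \<in> W k" "q \<in> W k" "\<not> (R k p q \<or> R k q p)"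
      using j unfolding J_def by blast
    then show ?thesis
    proof cases
      case 1
      have "finite F" using 1(1) U finite_W finite_subset by blast
      with face_le[OF 1(1)] show ?thesis
        by (simp add: 1(2) summand_def face_def cone_def vertices_Diff)
    next
      case 2
      have "{p, q} \<in> U" using 2 by (intro nonchains) (auto simp: chain_def)
      from face_le[OF this] show ?thesis
        by (simp add: 2(1) summand_def ends_def face_def cone_def vertices_Diff)
          (simp add: vertices_def)
    qed
  qed
  have "outside k \<le> deg (mass_sum I ?P)"
  proof -
    \<comment> \<open>\<open>?u\<close> and \<open>?v\<close> read the two ends of the nonedge from
      the tag. The first is kept unless it belongs to the \<open>k\<close>-th model; in that case
      the second does not, because the nonedge is not inner.\<close>
    let ?u = "\<lambda>h n. fst (prod_decode (snd (prod_decode (fleft h n))))"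
    let ?v = "\<lambda>h n. snd (prod_decode (snd (prod_decode (fleft h n))))"
    let ?F = "\<lambda>h. fjoin (\<lambda>n. if fst (prod_decode (?u h n)) = k then ?v h n else ?u h n) (fright h)"
    have F: "recursive_functional ?F"
      unfolding fleft_def fright_def fjoin_def by (intro rf_intros)
    show ?thesis
      unfolding outside_def deg_le_iff
    proof (rule strong_leI[OF F])
      fix h assume "h \<in> mass_sum I ?P"
      then obtain j f where h': "h = fjoin (\<lambda>_. j) f" and j: "j \<in> I" and f': "f \<in> ?P j"
        unfolding mass_sum_def by blast
      from j obtain i where i: "i \<in> nonedges - ?inner" and ji: "j = prod_encode (0, i)"
        unfolding I_def by blast
      have h: "h = fjoin (\<lambda>_. prod_encode (0, i)) f" and f: "f \<in> nonbelow (ends i - vertices k G)"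
        using h' f' by (simp_all add: ji summand_def)
      from i obtain l p m q where lp: "i = prod_encode (prod_encode (l, p), prod_encode (m, q))"
        "p \<in> W l" "q \<in> W m" "\<not> (l = m \<and> (R l p q \<or> R l q p))"
        unfolding nonedges_def by blast
      then have "l \<noteq> k \<or> m \<noteq> k" using i by blast
      define u where "u = (if l = k then prod_encode (m, q) else prod_encode (l, p))"
      have "u \<in> other_vertices k"
        using lp \<open>l \<noteq> k \<or> m \<noteq> k\<close> unfolding u_def other_vertices_def by auto
      moreover have "u \<in> ends i - vertices k G"
        using \<open>l \<noteq> k \<or> m \<noteq> k\<close> by (auto simp: u_def lp(1) ends_def vertices_def)
      then have "f \<in> nonbelow {u}" using f by (auto simp: nonbelow_def)
      moreover have "?F h = fjoin (\<lambda>_. u) f"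
        by (simp add: h lp(1) u_def)
      ultimately show "?F h \<in> mass_sum (other_vertices k) (\<lambda>u. nonbelow {u})"
        unfolding mass_sum_def by auto
    qed
  qed
  moreover have "residuals k ((\<lambda>F. F - G) ` U) \<le> outside k"
    unfolding residuals_def by (rule Inf_fin.coboundedI[OF fin]) simp
  ultimately have "residuals k ((\<lambda>F. F - G) ` U) \<le> deg (mass_sum I ?P)" by (rule order_trans[rotated])
  from deg_mass_sum_finite[OF \<open>finite J\<close> this J]
  have "residuals k ((\<lambda>F. F - G) ` U) \<le> deg (mass_sum (summands U) ?P)" unfolding sub .
  also have "\<dots> \<le> c"
    using meets_residual[OF U G le[unfolded C]] by (simp add: C)
  finally show ?thesis .
qed

text \<open>After removal of \<open>w\<close> some summand would contain a computable function, and
  so would have had no vertex besides \<open>w\<close>. But a nonedge has two different ends by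
  reflexivity, and a member of \<open>U\<close> would have to be \<open>{}\<close> or
  \<open>{w}\<close>.\<close>

lemma meets_not_le_vertex:
  assumes U: "U \<subseteq> Pow (W k)" and "{} \<notin> U" and w: "w \<in> W k" "{w} \<notin> U"
  shows "\<not> meets k U \<le> face k {w}"
proof
  assume "meets k U \<le> face k {w}"
  \<comment> \<open>\<open>UNIV\<close> has a computable member, which the residual reduction maps
    to a computable member of the sum.\<close>
  then have "meets k U \<le> sup (face k {w}) (deg UNIV)" by (simp add: le_supI1)
  from meets_residual[OF U _ this] w(1)
  have "strong_le (mass_sum (summands U) (\<lambda>i. nonbelow (summand k i - vertices k {w}))) UNIV" by simp
  then obtain h where h: "h \<in> mass_sum (summands U) (\<lambda>i. nonbelow (summand k i - vertices k {w}))"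
    and computable: "turing_le h (\<lambda>_. 0)"
    unfolding strong_le_def turing_le_def by blast
  then obtain i f where i: "i \<in> summands U" and f: "f \<in> nonbelow (summand k i - vertices k {w})"
    and "h = fjoin (\<lambda>_. i) f"
    unfolding mass_sum_def by blast
  then have "turing_le f g" for g
    using turing_le_trans[OF turing_le_fjoin2[of f "\<lambda>_. i"] turing_le_trans[OF _ turing_le_const]] computable
    by blast
  then have "summand k i \<subseteq> vertices k {w}" using f unfolding nonbelow_def by blast
  from i consider j where "i = prod_encode (0, j)" "j \<in> nonedges" | F where "i = prod_encode (1, set_encode F)" "F \<in> U"
    unfolding summands_def by blast
  then show False
  proof cases
    case 1
    then show False
      using \<open>summand k i \<subseteq> vertices k {w}\<close> refl
      by (auto simp: summand_def ends_def vertices_def nonedges_def)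
  next
    case 2
    have "finite F" using 2(2) U finite_W finite_subset by blast
    then have "vertices k F \<subseteq> vertices k {w}"
      using \<open>summand k i \<subseteq> vertices k {w}\<close> by (simp add: 2(1) summand_def)
    then have "F \<subseteq> {w}" by (auto simp: vertices_def)
    with 2(2) assms show False by (metis subset_singleton_iff)
  qed
qed

section \<open>Regions of chains and the p-morphism onto the model\<close>

text \<open>For upward closed \<open>P\<close>, a chain contains a world satisfying \<open>P\<close> iff its largest element does.\<close>

definition region :: "nat \<Rightarrow> (nat \<Rightarrow> bool) \<Rightarrow> nat set set" where
  "region k P = {F. F \<subseteq> W k \<and> F \<noteq> {} \<and> (chain k F \<longrightarrow> (\<exists>p\<in>F. P p))}"

definition upward :: "nat \<Rightarrow> (nat \<Rightarrow> bool) \<Rightarrow> bool" where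
  "upward k P \<longleftrightarrow> (\<forall>p\<in>W k. \<forall>q\<in>W k. R k p q \<longrightarrow> P p \<longrightarrow> P q)"

lemma chain_subset: "chain k G \<Longrightarrow> F \<subseteq> G \<Longrightarrow> chain k F"
  unfolding chain_def by blast

lemma region_Pow: "region k P \<subseteq> Pow (W k)"
  unfolding region_def by blast

lemma region_upward: "F \<in> region k P \<Longrightarrow> F \<subseteq> G \<Longrightarrow> G \<subseteq> W k \<Longrightarrow> G \<in> region k P"
  unfolding region_def using chain_subset[of k G F] by blast

lemma region_nonchain: "F \<subseteq> W k \<Longrightarrow> \<not> chain k F \<Longrightarrow> F \<in> region k P"
  unfolding region_def by (auto simp: chain_def)

lemma region_disj: "region k (\<lambda>p. P p \<or> Q p) = region k P \<union> region k Q"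
  unfolding region_def by blast

text \<open>In a chain the two witnesses are comparable, and upward closure gives both properties to
  the larger one.\<close>

lemma region_conj:
  assumes "upward k P" "upward k Q"
  shows "region k (\<lambda>p. P p \<and> Q p) = region k P \<inter> region k Q"
proof (intro equalityI subsetI)
  fix F assume F: "F \<in> region k P \<inter> region k Q"
  have "\<exists>p\<in>F. P p \<and> Q p" if c: "chain k F"
  proof -
    obtain p q where pq: "p \<in> F" "q \<in> F" "P p" "Q q"
      using F c unfolding region_def by blast
    have "F \<subseteq> W k" using F unfolding region_def by blast
    with pq assms c show ?thesis unfolding upward_def chain_def by (meson subsetD)
  qed
  with F show "F \<in> region k (\<lambda>p. P p \<and> Q p)" unfolding region_def by blast
qed (auto simp: region_def)

text \<open>This rests on the back condition of the p-morphism: a world above the largest element of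
  a chain is reached by adding that world to the chain.\<close>

lemma region_imp:
  assumes P: "upward k P" and Q: "upward k Q" and F: "F \<subseteq> W k" "F \<noteq> {}"
  shows "F \<in> region k (\<lambda>p. \<forall>q\<in>W k. R k p q \<longrightarrow> P q \<longrightarrow> Q q) \<longleftrightarrow>
    (\<forall>G\<in>region k P. F \<union> G \<in> region k Q)"
proof
  assume I: "F \<in> region k (\<lambda>p. \<forall>q\<in>W k. R k p q \<longrightarrow> P q \<longrightarrow> Q q)"
  show "\<forall>G\<in>region k P. F \<union> G \<in> region k Q"
  proof
    fix G assume G: "G \<in> region k P"
    have "\<exists>p\<in>F \<union> G. Q p" if c: "chain k (F \<union> G)"
    proof -
      obtain p where p: "p \<in> F" "\<forall>q\<in>W k. R k p q \<longrightarrow> P q \<longrightarrow> Q q"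
        using I chain_subset[OF c, of F] unfolding region_def by blast
      obtain q where q: "q \<in> G" "P q"
        using G chain_subset[OF c, of G] unfolding region_def by blast
      have W: "p \<in> W k" "q \<in> W k" using F p q G unfolding region_def by auto
      have "R k p q \<or> R k q p" using c p q unfolding chain_def by blast
      then show ?thesis
      proof
        assume "R k p q"
        then have "Q q" using p(2) q(2) W by blast
        then show ?thesis using q(1) by blast
      next
        assume "R k q p"
        then have "P p" using P q(2) W unfolding upward_def by blast
        then have "Q p" using p(2) W refl by blast
        then show ?thesis using p(1) by blast
      qed
    qed
    with F G show "F \<union> G \<in> region k Q" unfolding region_def by blast
  qed
next
  assume I: "\<forall>G\<in>region k P. F \<union> G \<in> region k Q"
  have "\<exists>p\<in>F. \<forall>q\<in>W k. R k p q \<longrightarrow> P q \<longrightarrow> Q q" if c: "chain k F"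
  proof -
    have "finite F" using F finite_W finite_subset by blast
    \<comment> \<open>The largest element of the chain will be the required witness.\<close>
    have "\<exists>m\<in>F. \<forall>p\<in>F. R k p m"
      using \<open>finite F\<close> F(2,1) c
    proof (induction F rule: finite_ne_induct)
      case (singleton x)
      then show ?case using refl by simp
    next
      case (insert x F)
      then obtain m where m: "m \<in> F" "\<forall>p\<in>F. R k p m"
        using chain_subset[of k "insert x F" F] by blast
      have W: "x \<in> W k" "F \<subseteq> W k" using insert.prems by auto
      have "R k x m \<or> R k m x" using insert.prems m unfolding chain_def by blast
      then show ?case
      proof
        assume "R k x m"
        then show ?thesis using m by blast
      next
        assume "R k m x"
        then have "\<forall>p\<in>insert x F. R k p x" using m W trans refl by (metis insert_iff subsetD)
        then show ?thesis by blast
      qed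
    qed
    then obtain m where m: "m \<in> F" "\<forall>p\<in>F. R k p m" by blast
    have "Q q" if q: "q \<in> W k" "R k m q" "P q" for q
    proof -
      have pq: "R k p q" if "p \<in> F" for p
        using that m q F trans by (meson subsetD)
      \<comment> \<open>Singletons suffice as test sets, since \<open>F\<close> together with a
        world above its largest element is again a chain.\<close>
      have "{q} \<in> region k P" using q unfolding region_def by auto
      then have "F \<union> {q} \<in> region k Q" using I by blast
      moreover have "chain k (F \<union> {q})"
        using c pq refl[OF q(1)] unfolding chain_def by blast
      ultimately obtain p where "p \<in> F \<union> {q}" "Q p" unfolding region_def by blast
      then show "Q q" using pq Q F q(1) unfolding upward_def by blast
    qed
    with m show ?thesis by blast
  qed
  with F show "F \<in> region k (\<lambda>p. \<forall>q\<in>W k. R k p q \<longrightarrow> P q \<longrightarrow> Q q)"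
    unfolding region_def by blast
qed

section \<open>Truth values as finite meets of faces, and their implication\<close>

definition truth_value :: "nat \<Rightarrow> (nat \<Rightarrow> bool) \<Rightarrow> strong_degree" where
  "truth_value k P = meets k (region k P)"

lemma finite_meets: "finite (insert bound (face k ` region k P))"
  using finite_faces[OF region_Pow] by simp

lemma truth_value_le_bound: "truth_value k P \<le> bound"
  unfolding truth_value_def meets_def by (rule Inf_fin.coboundedI[OF finite_meets]) simp

lemma truth_value_le_face: "F \<in> region k P \<Longrightarrow> truth_value k P \<le> face k F"
  unfolding truth_value_def meets_def by (rule Inf_fin.coboundedI[OF finite_meets]) simp

lemma le_truth_valueI:
  "c \<le> bound \<Longrightarrow> (\<And>F. F \<in> region k P \<Longrightarrow> c \<le> face k F) \<Longrightarrow> c \<le> truth_value k P"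
  unfolding truth_value_def meets_def using finite_faces[OF region_Pow]
  by (intro Inf_fin.boundedI) auto

lemma truth_value_antimono: "region k P \<subseteq> region k Q \<Longrightarrow> truth_value k Q \<le> truth_value k P"
  by (intro le_truth_valueI truth_value_le_bound truth_value_le_face) auto

lemma le_sup_truth_value:
  assumes "c \<le> bound" "\<And>F G. F \<in> region k P \<Longrightarrow> G \<in> region k Q \<Longrightarrow> c \<le> face k (F \<union> G)"
  shows "c \<le> sup (truth_value k P) (truth_value k Q)"
  unfolding truth_value_def meets_def
  by (rule le_sup_Inf_fin)
    (use assms finite_meets in \<open>auto simp: face_Un intro: le_supI1 le_supI2\<close>)

lemma truth_value_conj:
  assumes "upward k P" "upward k Q"
  shows "truth_value k (\<lambda>p. P p \<and> Q p) = sup (truth_value k P) (truth_value k Q)"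
proof (rule antisym)
  show "truth_value k (\<lambda>p. P p \<and> Q p) \<le> sup (truth_value k P) (truth_value k Q)"
  proof (intro le_sup_truth_value truth_value_le_bound truth_value_le_face)
    fix F G assume FG: "F \<in> region k P" "G \<in> region k Q"
    then have "F \<union> G \<subseteq> W k" using region_Pow by blast
    with FG show "F \<union> G \<in> region k (\<lambda>p. P p \<and> Q p)"
      unfolding region_conj[OF assms] using region_upward by blast
  qed
  show "sup (truth_value k P) (truth_value k Q) \<le> truth_value k (\<lambda>p. P p \<and> Q p)"
    unfolding region_conj[OF assms]
    by (intro le_supI truth_value_antimono) (simp_all add: region_conj[OF assms])
qed

lemma truth_value_disj:
  "truth_value k (\<lambda>p. P p \<or> Q p) = inf (truth_value k P) (truth_value k Q)"
proof (rule antisym)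
  show "truth_value k (\<lambda>p. P p \<or> Q p) \<le> inf (truth_value k P) (truth_value k Q)"
    by (intro le_infI truth_value_antimono) (simp_all add: region_disj)
  show "inf (truth_value k P) (truth_value k Q) \<le> truth_value k (\<lambda>p. P p \<or> Q p)"
    using truth_value_le_bound truth_value_le_face
    by (intro le_truth_valueI) (auto simp: region_disj intro: le_infI1 le_infI2)
qed

text \<open>Only sets that are not chains remain in the region, and their faces lie above
  \<open>bound\<close>.\<close>

lemma truth_value_False: "truth_value k (\<lambda>_. False) = bound"
  by (intro antisym truth_value_le_bound le_truth_valueI order_refl)
    (auto simp: region_def intro: bound_le_face)

abbreviation base :: "nat \<Rightarrow> strong_degree" where
  "base k \<equiv> truth_value k (\<lambda>_. True)"

lemma base_le: "base k \<le> truth_value k P"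
  by (rule truth_value_antimono) (auto simp: region_def)

lemma truth_value_imp_upper:
  assumes P: "upward k P" and Q: "upward k Q"
  shows "truth_value k Q \<le> sup (truth_value k P) (truth_value k (\<lambda>p. \<forall>q\<in>W k. R k p q \<longrightarrow> P q \<longrightarrow> Q q))"
proof (intro le_sup_truth_value truth_value_le_bound truth_value_le_face)
  fix F G assume "F \<in> region k P" "G \<in> region k (\<lambda>p. \<forall>q\<in>W k. R k p q \<longrightarrow> P q \<longrightarrow> Q q)"
  moreover from this have "G \<subseteq> W k" "G \<noteq> {}" unfolding region_def by auto
  ultimately show "F \<union> G \<in> region k Q"
    using region_imp[OF P Q] by (simp add: Un_commute)
qed

text \<open>Each member \<open>G\<close> of the region of \<open>P\<close> yields a residual below
  \<open>c\<close>, and these residuals are joined over all \<open>G\<close>. The outcome is a meet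
  of \<open>outside k\<close> and faces of possibly empty sets; joining with \<open>base k\<close>
  repairs both defects.\<close>

lemma truth_value_imp_least:
  assumes P: "upward k P" and Q: "upward k Q"
    and le: "truth_value k Q \<le> sup (truth_value k P) c"
  shows "truth_value k (\<lambda>p. \<forall>q\<in>W k. R k p q \<longrightarrow> P q \<longrightarrow> Q q) \<le> sup (base k) c"
proof -
  \<comment> \<open>For \<open>T = region k P\<close>, the nonempty members are those of the region
    of the implication; a general \<open>T\<close> allows accumulating one \<open>G\<close> at a
    time.\<close>
  define joint where "joint = (\<lambda>T. {F. F \<subseteq> W k \<and> (\<forall>G\<in>T. F \<union> G \<in> region k Q)})"
  have joint_Pow: "joint T \<subseteq> Pow (W k)" for T unfolding joint_def by blast
  have step: "residuals k ((\<lambda>H. H - G) ` region k Q) \<le> c" if G: "G \<in> region k P" for G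
  proof (rule residuals_le[OF region_Pow region_nonchain])
    show "G \<subseteq> W k" using G region_Pow by blast
    have "truth_value k Q \<le> sup (face k G) c"
      using le truth_value_le_face[OF G] by (meson order_refl order_trans sup_mono)
    then show "meets k (region k Q) \<le> sup (face k G) c" unfolding truth_value_def .
  qed
  have "residuals k (joint T) \<le> c" if "finite T" "T \<subseteq> region k P" for T
    using that
  proof (induction T)
    case empty
    \<comment> \<open>With no condition to satisfy, the empty set qualifies, and its face is
      \<open>bot\<close>.\<close>
    have "face k {} \<in> insert (outside k) (face k ` joint {})" unfolding joint_def by auto
    from Inf_fin.coboundedI[OF _ this] finite_faces[OF joint_Pow] show ?case
      unfolding residuals_def face_empty by (simp add: bot_unique)
  next
    case (insert G T)
    have fin: "finite (insert (outside k) (face k ` joint U))" for U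
      using finite_faces[OF joint_Pow] by simp
    have "residuals k (joint (insert G T)) \<le>
        sup (residuals k (joint T)) (residuals k ((\<lambda>H. H - G) ` region k Q))"
      unfolding residuals_def[of k "joint T"] residuals_def[of k "(\<lambda>H. H - G) ` region k Q"]
    proof (rule le_sup_Inf_fin)
      fix x y assume x: "x \<in> insert (outside k) (face k ` joint T)"
        and y: "y \<in> insert (outside k) (face k ` (\<lambda>H. H - G) ` region k Q)"
      have out: "residuals k (joint (insert G T)) \<le> outside k"
        unfolding residuals_def by (rule Inf_fin.coboundedI[OF fin]) simp
      show "residuals k (joint (insert G T)) \<le> sup x y"
      proof (cases "x = outside k \<or> y = outside k")
        case True
        then show ?thesis using out by (auto intro: le_supI1 le_supI2)
      next
        case False
        then obtain F H where F: "F \<in> joint T" "x = face k F" and H: "H \<in> region k Q" "y = face k (H - G)"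
          using x y by blast
        have "G \<in> region k P" using insert.prems by simp
        then have W: "G \<subseteq> W k" "H \<subseteq> W k" "F \<subseteq> W k"
          using H(1) F(1) by (simp_all add: region_def joint_def)
        \<comment> \<open>For \<open>G' = G\<close> this set contains \<open>H\<close>, otherwise it
          contains \<open>F \<union> G'\<close>; regions are closed under supersets within the
          model.\<close>
        have "F \<union> (H - G) \<union> G' \<in> region k Q" if G': "G' \<in> insert G T" for G'
        proof (cases "G' = G")
          case True
          show ?thesis by (rule region_upward[OF H(1)]) (use W True in auto)
        next
          case False
          with G' F(1) have "F \<union> G' \<in> region k Q" unfolding joint_def by simp
          then have "G' \<subseteq> W k" and FG: "F \<union> G' \<in> region k Q" unfolding region_def by simp_all
          from FG show ?thesis by (elim region_upward) (use W \<open>G' \<subseteq> W k\<close> in auto)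
        qed
        with W have "F \<union> (H - G) \<in> joint (insert G T)" unfolding joint_def by blast
        then have "residuals k (joint (insert G T)) \<le> face k (F \<union> (H - G))"
          unfolding residuals_def by (intro Inf_fin.coboundedI[OF fin]) simp
        then show ?thesis by (simp add: F(2) H(2) face_Un)
      qed
    qed (use finite_faces[OF joint_Pow] finite_faces[OF region_Pow] in auto)
    also have "\<dots> \<le> c" using insert step by simp
    finally show ?case .
  qed
  from this[OF finite_faces[OF region_Pow] order_refl]
  have c: "residuals k (joint (region k P)) \<le> c" .
  let ?I = "\<lambda>p. \<forall>q\<in>W k. R k p q \<longrightarrow> P q \<longrightarrow> Q q"
  \<comment> \<open>A face in \<open>base k\<close> belongs to a nonempty \<open>F\<close>. Any
    world of \<open>F\<close> lifts \<open>outside k\<close> above \<open>bound\<close>, and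
    \<open>F\<close> makes \<open>F \<union> F'\<close> nonempty, as \<open>region_imp\<close>
    requires.\<close>
  have "truth_value k ?I \<le> sup (base k) (residuals k (joint (region k P)))"
    unfolding truth_value_def[of k "\<lambda>_. True"] meets_def residuals_def
  proof (rule le_sup_Inf_fin)
    fix x y assume x: "x \<in> insert bound (face k ` region k (\<lambda>_. True))"
      and y: "y \<in> insert (outside k) (face k ` joint (region k P))"
    from x consider "x = bound" | F where "F \<in> region k (\<lambda>_. True)" "x = face k F" by blast
    then show "truth_value k ?I \<le> sup x y"
    proof cases
      case 1
      then show ?thesis using truth_value_le_bound by (simp add: le_supI1)
    next
      case 2
      then have F: "F \<subseteq> W k" "F \<noteq> {}" unfolding region_def by auto
      show ?thesis
      proof (cases "y = outside k")
        case True
        obtain p where "p \<in> F" using F by blast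
        then have "bound \<le> sup (face k {p}) (outside k)" using F bound_le_sup_outside by blast
        also have "\<dots> \<le> sup x y"
          using \<open>p \<in> F\<close> by (simp add: True 2(2) le_supI1 face_mono)
        finally show ?thesis using truth_value_le_bound by (rule order_trans[rotated])
      next
        case False
        then obtain F' where F': "F' \<in> joint (region k P)" "y = face k F'" using y by blast
        have "F \<union> F' \<union> G \<in> region k Q" if "G \<in> region k P" for G
        proof (rule region_upward)
          show "F' \<union> G \<in> region k Q" using F'(1) that unfolding joint_def by blast
          show "F' \<union> G \<subseteq> F \<union> F' \<union> G" by blast
          show "F \<union> F' \<union> G \<subseteq> W k" using F F'(1) that joint_Pow region_Pow by blast
        qed
        then have "F \<union> F' \<in> region k ?I"
          using F F'(1) by (subst region_imp[OF P Q]) (auto simp: joint_def)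
        from truth_value_le_face[OF this] show ?thesis by (simp add: 2(2) F'(2) face_Un)
      qed
    qed
  qed (use finite_meets finite_faces[OF joint_Pow] in auto)
  also have "\<dots> \<le> sup (base k) c" using c by (simp add: le_supI2)
  finally show ?thesis .
qed

section \<open>The valuation that refutes a sentence through its model\<close>

primrec counter_valuation :: "nat \<Rightarrow> sentence \<Rightarrow> strong_degree" where
  "counter_valuation k (Atom a) = truth_value k (V k a)"
| "counter_valuation k (Conj \<phi> \<psi>) = sup (counter_valuation k \<phi>) (counter_valuation k \<psi>)"
| "counter_valuation k (Disj \<phi> \<psi>) = inf (counter_valuation k \<phi>) (counter_valuation k \<psi>)"
| "counter_valuation k (Impl \<phi> \<psi>) = dimp (counter_valuation k \<phi>) (counter_valuation k \<psi>)"
| "counter_valuation k (Neg \<phi>) = dimp (counter_valuation k \<phi>) bound"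

lemma counter_valuation_le: "counter_valuation k \<phi> \<le> bound"
  by (induction \<phi>) (auto intro: truth_value_le_bound le_infI1 order_trans[OF dimp_le])

lemma valuation_counter_valuation:
  "valuation (inv_gorder (interval_order bot bound)) (counter_valuation k)"
  unfolding valuation_dual_interval by (simp add: counter_valuation_le)

lemma upward_forces: "upward k (forces (W k) (R k) (V k) \<phi>)"
proof (induction \<phi>)
  case (Atom a)
  then show ?case using persistent by (auto simp: upward_def)
next
  case (Impl \<phi> \<psi>)
  show ?case unfolding upward_def forces.simps using trans by blast
next
  case (Neg \<phi>)
  show ?case unfolding upward_def forces.simps using trans by blast
qed (auto simp: upward_def)

text \<open>Joining with \<open>base k\<close> passes to a quotient in which \<open>dimp\<close>
  becomes the implication of the model. One inequality holds because every truth value absorbs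
  \<open>base k\<close>, the other is leastness modulo \<open>base k\<close>.\<close>

lemma dimp_sup_base:
  assumes P: "upward k P" and Q: "upward k Q"
    and a: "sup a (base k) = truth_value k P" and b: "sup b (base k) = truth_value k Q"
  shows "sup (dimp a b) (base k) = truth_value k (\<lambda>p. \<forall>q\<in>W k. R k p q \<longrightarrow> P q \<longrightarrow> Q q)"
proof (rule antisym)
  let ?I = "\<lambda>p. \<forall>q\<in>W k. R k p q \<longrightarrow> P q \<longrightarrow> Q q"
  have "b \<le> truth_value k Q" using b by (metis sup_ge1)
  also have "\<dots> \<le> sup (truth_value k P) (truth_value k ?I)" by (rule truth_value_imp_upper[OF P Q])
  also have "\<dots> = sup a (truth_value k ?I)"
    unfolding a[symmetric] using base_le[of k ?I] by (simp add: sup.assoc sup_absorb2)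
  finally show "sup (dimp a b) (base k) \<le> truth_value k ?I"
    by (simp add: dimp_le_iff base_le)
  have "truth_value k Q \<le> sup (truth_value k P) (dimp a b)"
    unfolding a[symmetric] b[symmetric]
  proof (rule le_supI)
    show "b \<le> sup (sup a (base k)) (dimp a b)"
      by (rule order_trans[OF dimp_self[of b a]]) (rule sup_mono, simp_all)
  qed (simp add: le_supI1)
  from truth_value_imp_least[OF P Q this] show "truth_value k ?I \<le> sup (dimp a b) (base k)"
    by (simp add: sup.commute)
qed

lemma counter_valuation_forces:
  "sup (counter_valuation k \<phi>) (base k) = truth_value k (forces (W k) (R k) (V k) \<phi>)"
proof (induction \<phi>)
  case (Atom a)
  have "forces (W k) (R k) (V k) (Atom a) = V k a" by (simp add: fun_eq_iff)
  then show ?case using base_le by (simp add: sup_absorb1)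
next
  case (Conj \<phi> \<psi>)
  have "sup (counter_valuation k (Conj \<phi> \<psi>)) (base k) =
      sup (sup (counter_valuation k \<phi>) (base k)) (sup (counter_valuation k \<psi>) (base k))"
    by (simp add: sup.assoc sup.left_commute)
  then show ?case using Conj truth_value_conj[OF upward_forces upward_forces] by simp
next
  case (Disj \<phi> \<psi>)
  then show ?case by (simp add: sup_inf_distrib2 truth_value_disj)
next
  case (Impl \<phi> \<psi>)
  then show ?case using dimp_sup_base[OF upward_forces upward_forces] by simp
next
  case (Neg \<phi>)
  \<comment> \<open>Negation is treated as implication into falsity, whose truth value is
    \<open>bound\<close>.\<close>
  have "upward k (\<lambda>_. False)" by (simp add: upward_def)
  moreover have "sup bound (base k) = truth_value k (\<lambda>_. False)"
    using truth_value_le_bound by (simp add: truth_value_False sup_absorb1)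
  ultimately show ?case using dimp_sup_base[OF upward_forces _ Neg] by simp
qed

text \<open>The face of the one-element chain \<open>{w}\<close> separates: it lies above
  \<open>base k\<close>, but not above the truth value of a sentence that fails at
  \<open>w\<close>.\<close>

lemma counter_valuation_refutes:
  assumes "w \<in> W k" "\<not> forces (W k) (R k) (V k) \<phi> w"
  shows "counter_valuation k \<phi> \<noteq> bot"
proof
  let ?P = "forces (W k) (R k) (V k) \<phi>"
  assume "counter_valuation k \<phi> = bot"
  then have "truth_value k ?P = base k"
    using counter_valuation_forces[of k \<phi>] by (simp add: sup_absorb2)
  moreover have "base k \<le> face k {w}"
    using assms(1) by (intro truth_value_le_face) (auto simp: region_def)
  ultimately have "meets k (region k ?P) \<le> face k {w}" unfolding truth_value_def by simp
  moreover have "{w} \<notin> region k ?P"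
    using assms refl by (auto simp: region_def chain_def)
  ultimately show False
    using meets_not_le_vertex[OF region_Pow _ assms(1)] by (auto simp: region_def)
qed

end

instance sentence :: countable
  by countable_datatype

theorem theoremK:
  shows "\<exists>r::strong_degree. dual_theory_of (interval_order bot r) = IPC"
proof -
  \<comment> \<open>The \<open>k\<close>-th model is assigned to the sentence with code
    \<open>k\<close>.\<close>
  have ex: "\<exists>M. case M of (W, R, V) \<Rightarrow> finite_kripke_model W R V \<and>
      (\<not> intuitionistic_provable (from_nat k) \<longrightarrow> (\<exists>w\<in>W. \<not> forces W R V (from_nat k) w))" for k
  proof (cases "intuitionistic_provable (from_nat k)")
    case True
    \<comment> \<open>A provable sentence has no countermodel; the empty model fills its
      place.\<close>
    then show ?thesis
      by (intro exI[of _ "({}, \<lambda>_ _. True, \<lambda>_ _. True)"]) (simp add: finite_kripke_model_def)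
  next
    case False
    then show ?thesis using kripke_completeness by auto
  qed
  from choice[OF allI, OF ex] obtain M where M: "\<forall>k. case M k of (W, R, V) \<Rightarrow> finite_kripke_model W R V \<and>
      (\<not> intuitionistic_provable (from_nat k) \<longrightarrow> (\<exists>w\<in>W. \<not> forces W R V (from_nat k) w))"
    by (rule exE)
  define W R V where "W = (\<lambda>k. fst (M k))" and "R = (\<lambda>k. fst (snd (M k)))" and "V = (\<lambda>k. snd (snd (M k)))"
  have model: "finite_kripke_model (W k) (R k) (V k)"
    and refutes: "\<not> intuitionistic_provable (from_nat k) \<Longrightarrow> \<exists>w\<in>W k. \<not> forces (W k) (R k) (V k) (from_nat k) w" for k
    using spec[OF M, of k] by (auto simp: W_def R_def V_def split: prod.splits)
  interpret models W R V by unfold_locales (rule model)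
  have "intuitionistic_provable \<phi>"
    if \<phi>: "\<And>v. valuation (inv_gorder (interval_order bot bound)) v \<Longrightarrow> v \<phi> = bot" for \<phi>
  proof (rule ccontr)
    assume "\<not> intuitionistic_provable \<phi>"
    with refutes[of "to_nat \<phi>"] counter_valuation_refutes[of _ "to_nat \<phi>" \<phi>]
      \<phi>[OF valuation_counter_valuation] show False by auto
  qed
  with IPC_sound have "dual_theory_of (interval_order bot bound) = IPC"
    unfolding dual_theory_of_initial_segment IPC_def by blast
  then show ?thesis by blast
qed

end
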